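(* Let $r\ge1$, $M>0$ and $\epsilon>0$. Let $h$ be a concave-function transformation such that $g\equiv h^{1/2}$ satisfies the following, where $\tilde y_0<\tilde y_\infty$ are the limit points of $g$: (T.1) $g'(y)=o(|y|^{-(\alpha+1)})$ as $y\searrow-\infty$, for some $\alpha=\alpha_g>\max(1/r,1/2)$; (T.2) if $\tilde y_0>-\infty$, then for every $\tilde y_0<c<\tilde y_\infty$ there is $0<M_c<\infty$ with $g'(y)\le M_c$ for all $y\in(\tilde y_0,c]$; (T.3) if $\tilde y_\infty<\infty$, then for some $0<c<C$ and some $\beta>1$, $c(\tilde y_\infty-y)^{-\beta}\le g(y)\le C(\tilde y_\infty-y)^{-\beta}$ for $y<\tilde y_\infty$ in a neighborhood of $\tilde y_\infty$; (T.4) if $\tilde y_\infty=\infty$, then $g(y)^{\gamma}g(-Cy)=o(1)$ as $y\to\infty$, for some $\gamma,C>0$. Then $$\log N_{[\,]}(\epsilon,\mathcal{P}_{M,h}^{1/2},L_r)\le K_{r,M,h}\,\epsilon^{-1/2},$$ where $K_{r,M,h}<\infty$ is a constant depending only on $r$, $M$ and $h$ (not on $\epsilon$).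
   Context: A concave-function transformation is an increasing function $h:[-\infty,\infty]\to[0,\infty]$ with $h(-\infty)=0$ and $h(\infty)=\infty$, continuously differentiable (on $(\tilde y_0,\tilde y_\infty)$), where its limit points are $\tilde y_0=\inf\{y:h(y)>0\}$ and $\tilde y_\infty=\sup\{y:h(y)<\infty\}$; it is assumed that $\tilde y_0<\tilde y_\infty$, $h(\tilde y_0)=0$ and $h(\tilde y_\infty)=\infty$, with $h$ continuous. Let $\mathcal{C}$ be the set of closed (upper semicontinuous), proper concave functions $\varphi:\mathbb{R}\to[-\infty,\infty)$, $\lambda$ Lebesgue measure, $\mathcal{P}_h=\{p=h\circ\varphi:\varphi\in\mathcal{C},\int p\,d\lambda=1\}$, and for $0<M<\infty$ $$\mathcal{P}_{M,h}=\{p\in\mathcal{P}_h:\ \sup_{x\in\mathbb{R}}p(x)\le M,\ 1/M\le p(x)\text{ for all }|x|\le1\},\qquad \mathcal{P}_{M,h}^{1/2}=\{p^{1/2}:p\in\mathcal{P}_{M,h}\}.$$ $L_r(f,g)=(\int|f-g|^r\,d\lambda)^{1/r}$, and $N_{[\,]}(\epsilon,\mathcal{F},L_r)$ is the minimal number of brackets $[l,u]=\{f:l\le f\le u\}$ with $L_r(l,u)\le\epsilon$ whose union contains $\mathcal{F}$. *)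

theory Defs
  imports "HOL-Analysis.Analysis" "HOL-Library.Landau_Symbols"
begin

text \<open>Power with a positive exponent on \<open>[0,\<infinity>]\<close>, with \<open>\<infinity> powr a = \<infinity>\<close>; the library only
  has \<open>powr\<close> on the reals.\<close>

definition ennreal_powr :: "ennreal \<Rightarrow> real \<Rightarrow> ennreal" where
  "ennreal_powr x a = (if x = \<infinity> then \<infinity> else ennreal (enn2real x powr a))"

definition lower_limit_point :: "(ereal \<Rightarrow> ennreal) \<Rightarrow> ereal" where
  "lower_limit_point h = Inf {y. h y > 0}"

definition upper_limit_point :: "(ereal \<Rightarrow> ennreal) \<Rightarrow> ereal" where
  "upper_limit_point h = Sup {y. h y < \<infinity>}"

text \<open>The transformation as a real function of a real argument, used for derivatives and growth
  conditions. It only carries information where \<open>h\<close> is finite, that is, below the upper limit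
  point; \<open>enn2real \<infinity> = 0\<close>.\<close>

definition real_fun :: "(ereal \<Rightarrow> ennreal) \<Rightarrow> real \<Rightarrow> real" where
  "real_fun h y = enn2real (h (ereal y))"

text \<open>``Increasing'' is in the weak sense: \<open>h\<close> vanishes on all of \<open>[-\<infinity>, lower_limit_point h]\<close>.\<close>

definition concave_function_transformation :: "(ereal \<Rightarrow> ennreal) \<Rightarrow> bool" where
  "concave_function_transformation h \<longleftrightarrow>
     mono h \<and> h (-\<infinity>) = 0 \<and> h \<infinity> = \<infinity> \<and> continuous_on UNIV h \<and>
     lower_limit_point h < upper_limit_point h \<and>
     h (lower_limit_point h) = 0 \<and> h (upper_limit_point h) = \<infinity> \<and>
     real_fun h C1_differentiable_on
       {y. lower_limit_point h < ereal y \<and> ereal y < upper_limit_point h}"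

definition sqrt_transformation :: "(ereal \<Rightarrow> ennreal) \<Rightarrow> ereal \<Rightarrow> ennreal" where
  "sqrt_transformation h y = ennreal_powr (h y) (1/2)"

definition cond_T1 :: "(ereal \<Rightarrow> ennreal) \<Rightarrow> real \<Rightarrow> bool" where
  "cond_T1 g r \<longleftrightarrow>
     (\<exists>\<alpha> > max (1/r) (1/2). deriv (real_fun g) \<in> o[at_bot](\<lambda>y. \<bar>y\<bar> powr (-(\<alpha> + 1))))"

definition cond_T2 :: "(ereal \<Rightarrow> ennreal) \<Rightarrow> bool" where
  "cond_T2 g \<longleftrightarrow>
     (lower_limit_point g > -\<infinity> \<longrightarrow>
       (\<forall>c::real. lower_limit_point g < ereal c \<and> ereal c < upper_limit_point g \<longrightarrow>
         (\<exists>Mc > 0. \<forall>y. lower_limit_point g < ereal y \<and> y \<le> c \<longrightarrow> deriv (real_fun g) y \<le> Mc)))"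

definition cond_T3 :: "(ereal \<Rightarrow> ennreal) \<Rightarrow> bool" where
  "cond_T3 g \<longleftrightarrow>
     (upper_limit_point g < \<infinity> \<longrightarrow>
       (\<exists>c C \<beta>. 0 < c \<and> c < C \<and> \<beta> > 1 \<and>
         (let b = real_of_ereal (upper_limit_point g) in
           \<forall>\<^sub>F y in at_left b. c * (b - y) powr (-\<beta>) \<le> real_fun g y \<and>
                              real_fun g y \<le> C * (b - y) powr (-\<beta>))))"

definition cond_T4 :: "(ereal \<Rightarrow> ennreal) \<Rightarrow> bool" where
  "cond_T4 g \<longleftrightarrow>
     (upper_limit_point g = \<infinity> \<longrightarrow>
       (\<exists>\<gamma> C. \<gamma> > 0 \<and> C > 0 \<and>
         (\<lambda>y. real_fun g y powr \<gamma> * real_fun g (-C * y)) \<in> o[at_top](\<lambda>_. 1)))"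

definition hypograph :: "(real \<Rightarrow> ereal) \<Rightarrow> (real \<times> real) set" where
  "hypograph \<phi> = {(x, t). ereal t \<le> \<phi> x}"

definition closed_proper_concave :: "(real \<Rightarrow> ereal) set" where
  "closed_proper_concave =
     {\<phi>. (\<forall>x. \<phi> x < \<infinity>) \<and> (\<exists>x. \<phi> x > -\<infinity>) \<and> convex (hypograph \<phi>) \<and>
         (\<forall>x. Limsup (at x) \<phi> \<le> \<phi> x)}"

definition dens_class :: "(ereal \<Rightarrow> ennreal) \<Rightarrow> (real \<Rightarrow> ennreal) set" where
  "dens_class h =
     {p. (\<exists>\<phi> \<in> closed_proper_concave. p = h \<circ> \<phi>) \<and> (\<integral>\<^sup>+x. p x \<partial>lborel) = 1}"

definition dens_class_bounded :: "real \<Rightarrow> (ereal \<Rightarrow> ennreal) \<Rightarrow> (real \<Rightarrow> ennreal) set" where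
  "dens_class_bounded M h =
     {p \<in> dens_class h. (SUP x. p x) \<le> ennreal M \<and> (\<forall>x. \<bar>x\<bar> \<le> 1 \<longrightarrow> ennreal (1 / M) \<le> p x)}"

text \<open>Members of \<open>dens_class_bounded M h\<close> are finite-valued, so their square roots are taken as
  real functions without loss.\<close>

definition sqrt_dens_class :: "real \<Rightarrow> (ereal \<Rightarrow> ennreal) \<Rightarrow> (real \<Rightarrow> real) set" where
  "sqrt_dens_class M h = (\<lambda>p x. sqrt (enn2real (p x))) ` dens_class_bounded M h"

definition Lr_dist :: "real \<Rightarrow> (real \<Rightarrow> real) \<Rightarrow> (real \<Rightarrow> real) \<Rightarrow> ennreal" where
  "Lr_dist r f g = ennreal_powr (\<integral>\<^sup>+x. ennreal (\<bar>f x - g x\<bar> powr r) \<partial>lborel) (1 / r)"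

text \<open>\<open>{l..u}\<close> is the interval for the pointwise order on functions. Measurability of the end
  points makes the Lebesgue integral in \<open>Lr_dist\<close> meaningful. The value is \<open>\<infinity>\<close> if no finite
  family of brackets covers \<open>F\<close>.\<close>

definition bracketing_number ::
    "real \<Rightarrow> (real \<Rightarrow> real) set \<Rightarrow> real \<Rightarrow> enat" where
  "bracketing_number \<epsilon> F r =
     (INF B \<in> {B. finite B \<and>
                  (\<forall>(l, u) \<in> B. l \<in> borel_measurable lborel \<and> u \<in> borel_measurable lborel \<and>
                                Lr_dist r l u \<le> ennreal \<epsilon>) \<and>
                  F \<subseteq> (\<Union>(l, u) \<in> B. {l..u})}.
        enat (card B))"

definition log_enat :: "enat \<Rightarrow> ereal" where
  "log_enat n = (case n of enat k \<Rightarrow> if k = 0 then -\<infinity> else ereal (ln (real k)) | \<infinity> \<Rightarrow> \<infinity>)"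

end

theory Submission
  imports Defs
begin

text \<open>Write a member of the class as \<open>g \<circ> \<phi>\<close>. The bounds on \<open>[-1, 1]\<close>, the upper bound \<open>M\<close> and
  \<open>\<integral>p = 1\<close> force \<open>\<phi> < B\<close> and \<open>B + 1 - \<phi> x \<ge> \<kappa> \<bar>x\<bar>\<close> with \<open>B\<close>, \<open>\<kappa>\<close> depending only on \<open>M\<close> and \<open>h\<close>. Cutting
  the range of \<open>\<phi>\<close> at the levels \<open>B + 1 - 2 ^ l\<close> writes \<open>g \<circ> \<phi>\<close> as a sum of slices; after rescaling,
  slice \<open>l\<close> is a Lipschitz function (with constant of order \<open>2 powr (-\<alpha> l)\<close> by (T.1) and (T.2)) of a
  function on \<open>[0, 1]\<close> with values in \<open>[0, 1]\<close> that is concave where it is positive.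

  For such functions an adaptive dyadic subdivision gives the rate \<open>\<epsilon> powr (-1/2)\<close>: an interval of
  length \<open>2 ^ -j\<close> is split as long as the function deviates from its chord by more than a tolerance
  that grows with \<open>j\<close>. At each level at most \<open>7 / sqrt t\<close> intervals have deviation exceeding \<open>t\<close>, because
  the second differences of a bounded concave sequence are small on average. The rounded midpoint
  values on the splitting tree encode a bracket, and a Kraft inequality counts the codes.\<close>

text \<open>The exponent 1/2 is a second-order approximation rate: about 2^j0 linear pieces resolve
  a concave function to 4^-j0. A uniform grid misses this, since a slice can be arbitrarily steep
  near the ends of its positivity set and may jump to 0 there. Only the integrated error matters, so
  short intervals can afford a large tolerance; letting its r-th power grow like 2^j keeps the error
  per leaf constant and ends the splitting near a jump. The second obstacle is a logarithmic factor:
  coding every value separately to the final precision costs log (1/\<epsilon>) per interval. A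
  label here only corrects a midpoint against the mean of its neighbours, and its price is the
  number of doublings by which the deviation exceeds the tolerance. Summed over intervals, levels
  and doublings, these prices stay of order 2^j0.\<close>

section \<open>Second differences of bounded concave sequences\<close>

text \<open>The induction adds indices from right to left. Each drop raises the increment by more
  than t, so the increment before the k-th index from the right is at least k t. The increments
  between are nonnegative, hence y climbs by t + 2 t + ... + m t in all, and y \<le> 1 caps
  this.\<close>

lemma card_increments_drop_nonneg:
  fixes y d :: "nat \<Rightarrow> real"
  assumes "finite A" "A \<noteq> {}" "A \<subseteq> {p<..q}" "t > 0"
    and step: "\<And>i. y (Suc i) = y i + d i" and le1: "\<And>i. y i \<le> 1"
    and anti: "\<And>i k. p \<le> i \<Longrightarrow> i \<le> k \<Longrightarrow> k \<le> q \<Longrightarrow> d k \<le> d i"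
    and drop: "\<And>i. i \<in> A \<Longrightarrow> d (i - 1) - d i > t \<and> 0 \<le> d i"
  shows "y (Min A - 1) + t * real (card A) * (real (card A) + 1) / 2 \<le> 1 \<and>
         t * real (card A) \<le> d (Min A - 1)"
  using assms(1-3) drop
proof (induction A rule: finite_linorder_min_induct)
  case (insert b A)
  have b: "p < b" "b \<le> q" "d (b - 1) - d b > t" "0 \<le> d b"
    using insert.prems by auto
  have yb: "y b = y (b - 1) + d (b - 1)"
    using step[of "b - 1"] b(1) by simp
  show ?case
  proof (cases "A = {}")
    case True
    then show ?thesis using b yb le1[of b] by simp
  next
    case False
    let ?m = "real (card A)" and ?c = "Min A"
    have IH: "y (?c - 1) + t * ?m * (?m + 1) / 2 \<le> 1" "t * ?m \<le> d (?c - 1)"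
      using insert False by auto
    have c: "?c \<in> A" using insert False by simp
    have bc: "b < ?c" "?c \<le> q" using c insert by auto
    have d1: "d (?c - 1) \<le> d b" using anti[of b "?c - 1"] b bc by simp
    have nn: "0 \<le> d (?c - 1)" using IH(2) \<open>t > 0\<close> by (meson mult_nonneg_nonneg of_nat_0_le_iff order_less_imp_le order_trans)
    have mono: "y b \<le> y k" if "b \<le> k" "k \<le> ?c - 1" for k
      using that
    proof (induction k rule: dec_induct)
      case (step k)
      have "d (?c - 1) \<le> d k" using anti[of k "?c - 1"] step.hyps step.prems b bc by simp
      then show ?case using step assms(5)[of k] nn by simp
    qed simp
    have "y b \<le> y (?c - 1)" using mono[of "?c - 1"] bc by simp
    moreover have "Min (insert b A) = b" "card (insert b A) = Suc (card A)"
      using insert.hyps by (auto simp: Min_insert2 less_imp_le)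
    moreover have "d (b - 1) \<ge> t * (?m + 1)"
      using b d1 IH(2) by (simp add: algebra_simps)
    ultimately show ?thesis using yb IH(1) by (simp add: field_simps)
  qed
qed simp

text \<open>Mirror image, adding indices from left to right while y falls. The first drop may start
  at a positive increment and end barely below 0, so it guarantees nothing: hence
  \<open>card A - 1\<close> in place of \<open>card A\<close>.\<close>

lemma card_increments_drop_neg:
  fixes y d :: "nat \<Rightarrow> real"
  assumes "finite A" "A \<noteq> {}" "A \<subseteq> {p<..q}" "t > 0"
    and step: "\<And>i. y (Suc i) = y i + d i" and le1: "\<And>i. y i \<le> 1"
    and anti: "\<And>i k. p \<le> i \<Longrightarrow> i \<le> k \<Longrightarrow> k \<le> q \<Longrightarrow> d k \<le> d i"
    and drop: "\<And>i. i \<in> A \<Longrightarrow> d (i - 1) - d i > t \<and> d i < 0"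
  shows "y (Suc (Max A)) + t * real (card A) * (real (card A) - 1) / 2 \<le> 1 \<and>
         t * (real (card A) - 1) \<le> - d (Max A)"
  using assms(1-3) drop
proof (induction A rule: finite_linorder_max_induct)
  case (insert b A)
  have b: "p < b" "b \<le> q" "d (b - 1) - d b > t" "d b < 0"
    using insert.prems by auto
  show ?case
  proof (cases "A = {}")
    case True
    then show ?thesis using b le1[of "Suc b"] by simp
  next
    case False
    let ?m = "real (card A)" and ?c = "Max A"
    have IH: "y (Suc ?c) + t * ?m * (?m - 1) / 2 \<le> 1" "t * (?m - 1) \<le> - d ?c"
      using insert False by auto
    have c: "?c \<in> A" using insert False by simp
    have bc: "?c < b" "p < ?c" "d ?c < 0" using c insert by auto
    have d1: "d (b - 1) \<le> d ?c" using anti[of ?c "b - 1"] b bc by simp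
    have mono: "y k \<le> y (Suc ?c)" if "Suc ?c \<le> k" "k \<le> b" for k
      using that
    proof (induction k rule: dec_induct)
      case (step k)
      have "d k \<le> d ?c" using anti[of ?c k] step.hyps step.prems b bc by simp
      then show ?case using step assms(5)[of k] bc by simp
    qed simp
    have "y b \<le> y (Suc ?c)" using mono[of b] bc by simp
    moreover have "Max (insert b A) = b" "card (insert b A) = Suc (card A)"
      using insert.hyps by (auto simp: Max_insert2 less_imp_le)
    moreover have "- d b \<ge> t * ?m"
      using b d1 IH(2) by (simp add: algebra_simps)
    ultimately show ?thesis using step[of b] IH(1) by (simp add: field_simps)
  qed
qed simp

text \<open>A concave sequence first rises and then falls. Dividing the indices by the sign of
  \<open>d\<close> leaves a quadratic inequality on each side; the summand 1 is the drop lost in the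
  falling part.\<close>

lemma card_second_difference_le:
  fixes y d :: "nat \<Rightarrow> real"
  assumes "finite A" "A \<subseteq> {p<..q}" "t > 0"
    and step: "\<And>i. y (Suc i) = y i + d i" and bnd: "\<And>i. 0 \<le> y i" "\<And>i. y i \<le> 1"
    and anti: "\<And>i k. p \<le> i \<Longrightarrow> i \<le> k \<Longrightarrow> k \<le> q \<Longrightarrow> d k \<le> d i"
    and drop: "\<And>i. i \<in> A \<Longrightarrow> d (i - 1) - d i > t"
  shows "real (card A) \<le> 1 + 2 * sqrt (2 / t)"
proof -
  let ?P = "{i \<in> A. 0 \<le> d i}" and ?N = "{i \<in> A. d i < 0}"
  have bound: "x \<le> sqrt (2 / t)" if "t * x * x / 2 \<le> 1" for x
    using that \<open>t > 0\<close> by (intro real_le_rsqrt) (simp add: field_simps power2_eq_square)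
  have "real (card ?P) \<le> sqrt (2 / t)"
  proof (cases "?P = {}")
    case False
    have "y (Min ?P - 1) + t * real (card ?P) * (real (card ?P) + 1) / 2 \<le> 1"
      by (rule card_increments_drop_nonneg[of ?P p q t y d, THEN conjunct1]) (use assms False in auto)
    then have "t * real (card ?P) * (real (card ?P) + 1) / 2 \<le> 1"
      using bnd(1)[of "Min ?P - 1"] by linarith
    moreover have "t * real (card ?P) * real (card ?P) \<le> t * real (card ?P) * (real (card ?P) + 1)"
      using \<open>t > 0\<close> by (intro mult_left_mono) auto
    ultimately show ?thesis by (intro bound) linarith
  next
    case True
    then have "real (card ?P) = 0" by (metis card.empty of_nat_0)
    moreover have "0 \<le> sqrt (2 / t)" using \<open>t > 0\<close> by simp
    ultimately show ?thesis by linarith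
  qed
  moreover have "real (card ?N) - 1 \<le> sqrt (2 / t)"
  proof (cases "?N = {}")
    case False
    have "y (Suc (Max ?N)) + t * real (card ?N) * (real (card ?N) - 1) / 2 \<le> 1"
      by (rule card_increments_drop_neg[of ?N p q t y d, THEN conjunct1]) (use assms False in auto)
    then have "t * real (card ?N) * (real (card ?N) - 1) / 2 \<le> 1"
      using bnd(1)[of "Suc (Max ?N)"] by linarith
    moreover have "card ?N \<ge> 1" using False assms(1) by (simp add: Suc_leI card_gt_0_iff)
    then have "t * (real (card ?N) - 1) * (real (card ?N) - 1) \<le> t * real (card ?N) * (real (card ?N) - 1)"
      using \<open>t > 0\<close> by (intro mult_right_mono) auto
    ultimately show ?thesis by (intro bound) linarith
  next
    case True
    then have "real (card ?N) = 0" by (metis card.empty of_nat_0)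
    moreover have "0 \<le> sqrt (2 / t)" using \<open>t > 0\<close> by simp
    ultimately show ?thesis by linarith
  qed
  moreover have "card A = card ?P + card ?N"
    using assms(1) by (subst card_Un_disjoint[symmetric]) (auto intro: arg_cong[where f = card])
  ultimately show ?thesis by simp
qed

text \<open>The inequality makes \<open>{f > 0}\<close> convex and \<open>f\<close> concave on it,
  but allows a jump to 0 at either end. Cutting a concave function off from below preserves this
  property while it destroys concavity on the line; jumps occur where \<phi> falls to
  -\<infinity>.\<close>

definition trunc_concave :: "(real \<Rightarrow> real) set" where
  "trunc_concave = {f. (\<forall>x. 0 \<le> f x \<and> f x \<le> 1) \<and>
     (\<forall>x y s. 0 < f x \<longrightarrow> 0 < f y \<longrightarrow> 0 \<le> s \<longrightarrow> s \<le> 1 \<longrightarrow>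
        (1 - s) * f x + s * f y \<le> f ((1 - s) * x + s * y))}"

lemma trunc_concave_bounds:
  assumes "f \<in> trunc_concave" shows "0 \<le> f x" "f x \<le> 1"
  using assms by (auto simp: trunc_concave_def)

lemma trunc_concaveD:
  assumes "f \<in> trunc_concave" "0 < f x" "0 < f y" "0 \<le> s" "s \<le> 1"
  shows "(1 - s) * f x + s * f y \<le> f ((1 - s) * x + s * y)"
  using assms by (auto simp: trunc_concave_def)

text \<open>Multiplied by b - a so that it covers a = b and feeds linear arithmetic.\<close>

lemma trunc_concave_chord:
  assumes "f \<in> trunc_concave" "0 < f a" "0 < f b" "a \<le> x" "x \<le> b"
  shows "(b - x) * f a + (x - a) * f b \<le> (b - a) * f x"
proof (cases "a = b")
  case False
  then have ab: "a < b" using assms by simp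
  define s where "s = (x - a) / (b - a)"
  have s: "0 \<le> s" "s \<le> 1" "(b - a) * s = x - a"
    using ab assms by (auto simp: s_def)
  then have "(1 - s) * a + s * b = x" by (simp add: algebra_simps)
  note s = s(1,2) this s(3)
  have "(b - a) * ((1 - s) * f a + s * f b) \<le> (b - a) * f x"
    using trunc_concaveD[OF assms(1-3) s(1,2)] s(3) ab by (intro mult_left_mono) auto
  moreover have "(b - a) * ((1 - s) * f a + s * f b) = (b - a - (b - a) * s) * f a + ((b - a) * s) * f b"
    by (simp add: algebra_simps)
  ultimately show ?thesis by (simp add: s(4))
qed (use assms in auto)

lemma trunc_concave_pos:
  assumes "f \<in> trunc_concave" "0 < f a" "0 < f b" "a \<le> x" "x \<le> b"
  shows "0 < f x"
proof (cases "a = b")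
  case False
  then have ab: "a < b" using assms by simp
  have "0 < (b - x) * f a + (x - a) * f b"
  proof (cases "x = b")
    case False
    then show ?thesis using assms by (intro add_pos_nonneg mult_pos_pos mult_nonneg_nonneg) auto
  qed (use ab assms in simp)
  then have "0 < (b - a) * f x" using trunc_concave_chord[OF assms] by linarith
  then show ?thesis using ab by (simp add: zero_less_mult_iff)
qed (use assms in auto)

section \<open>Deviation from chords on dyadic intervals\<close>

definition chord :: "(real \<Rightarrow> real) \<Rightarrow> real \<Rightarrow> real \<Rightarrow> real \<Rightarrow> real" where
  "chord f a b x = f a + (f b - f a) * ((x - a) / (b - a))"

definition dyadic :: "nat \<Rightarrow> nat \<Rightarrow> real" where
  "dyadic j i = real i / 2 ^ j"

definition deviates :: "(real \<Rightarrow> real) \<Rightarrow> nat \<Rightarrow> nat \<Rightarrow> real \<Rightarrow> bool" where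
  "deviates f j i t \<longleftrightarrow>
     (\<exists>x \<in> {dyadic j i..dyadic j (Suc i)}. \<bar>f x - chord f (dyadic j i) (dyadic j (Suc i)) x\<bar> > t)"

lemma dyadic_Suc: "dyadic j (Suc i) = dyadic j i + 1 / 2 ^ j"
  by (simp add: dyadic_def field_simps)

lemma dyadic_mono: "i \<le> k \<Longrightarrow> dyadic j i \<le> dyadic j k"
  by (simp add: dyadic_def divide_right_mono)

lemma chord_between:
  assumes "a < b" "a \<le> x" "x \<le> b" "0 \<le> f a" "f a \<le> 1" "0 \<le> f b" "f b \<le> (1::real)"
  shows "0 \<le> chord f a b x" "chord f a b x \<le> 1"
proof -
  define s where "s = (x - a) / (b - a)"
  have s: "0 \<le> s" "s \<le> 1" using assms by (auto simp: s_def)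
  have eq: "chord f a b x = (1 - s) * f a + s * f b"
    by (simp add: chord_def s_def[symmetric] algebra_simps)
  show "0 \<le> chord f a b x" using s assms by (simp add: eq)
  show "chord f a b x \<le> 1" unfolding eq using s assms by (intro convex_bound_le) auto
qed

lemma not_deviates_1:
  assumes "f \<in> trunc_concave" "t \<ge> 1"
  shows "\<not> deviates f j i t"
proof
  assume "deviates f j i t"
  then obtain x where x: "dyadic j i \<le> x" "x \<le> dyadic j (Suc i)"
    "\<bar>f x - chord f (dyadic j i) (dyadic j (Suc i)) x\<bar> > t"
    by (auto simp: deviates_def)
  have "0 \<le> chord f (dyadic j i) (dyadic j (Suc i)) x" "chord f (dyadic j i) (dyadic j (Suc i)) x \<le> 1"
    by (rule chord_between; use x assms trunc_concave_bounds in \<open>auto simp: dyadic_Suc\<close>)+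
  then show False using x(3) trunc_concave_bounds[OF assms(1), of x] assms(2) by linarith
qed

text \<open>On [b, c] a concave function lies between its chord there and the prolongation of its
  chord over the left neighbour [a, b]. At relative position s these two lines differ by s times the
  second difference at b, and s \<le> 1.\<close>

lemma deviates_regular:
  assumes f: "f \<in> trunc_concave" and dev: "deviates f j i t" and "t > 0" "i \<ge> 1"
    and pos: "\<And>x. dyadic j (i - 1) \<le> x \<Longrightarrow> x \<le> dyadic j (Suc i) \<Longrightarrow> 0 < f x"
  shows "(f (dyadic j i) - f (dyadic j (i - 1))) - (f (dyadic j (Suc i)) - f (dyadic j i)) > t"
proof -
  define a b c where abc: "a = dyadic j (i - 1)" "b = dyadic j i" "c = dyadic j (Suc i)"
  define \<eta> :: real where "\<eta> = 1 / 2 ^ j"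
  have \<eta>: "\<eta> > 0" "b = a + \<eta>" "c = b + \<eta>"
    using dyadic_Suc[of j "i - 1"] dyadic_Suc[of j i] \<open>i \<ge> 1\<close> by (auto simp: abc \<eta>_def)
  obtain x where x: "b \<le> x" "x \<le> c" "\<bar>f x - chord f b c x\<bar> > t"
    using dev by (auto simp: deviates_def abc)
  define s where "s = (x - b) / \<eta>"
  have s: "0 \<le> s" "s \<le> 1" "x = b + s * \<eta>" using x \<eta> by (auto simp: s_def)
  have fp: "0 < f a" "0 < f b" "0 < f c" "0 < f x" using pos[folded abc] x \<eta> by auto
  have ch: "chord f b c x = f b + (f c - f b) * s" using \<eta> by (simp add: chord_def s_def)
  have "(c - x) * f b + (x - b) * f c \<le> (c - b) * f x"
    by (rule trunc_concave_chord) (use f fp x in auto)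
  moreover have "(c - x) * f b + (x - b) * f c = \<eta> * chord f b c x"
  proof -
    have "c - x = \<eta> * (1 - s)" "x - b = \<eta> * s" using s(3) \<eta>(3) by (auto simp: algebra_simps)
    then show ?thesis unfolding ch by (simp only:) (simp add: algebra_simps)
  qed
  ultimately have "\<eta> * chord f b c x \<le> \<eta> * f x" using \<eta>(3) by simp
  then have lower: "f x - chord f b c x > t" using x(3) \<eta> by simp
  have "(x - b) * f a + (b - a) * f x \<le> (x - a) * f b"
    by (rule trunc_concave_chord) (use f fp x \<eta> in auto)
  moreover have "x - b = \<eta> * s" "b - a = \<eta>" "x - a = \<eta> * (1 + s)"
    using s(3) \<eta> by (auto simp: algebra_simps)
  ultimately have "\<eta> * (s * f a + f x) \<le> \<eta> * ((1 + s) * f b)" by (simp add: algebra_simps)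
  then have "s * f a + f x \<le> (1 + s) * f b" using \<eta>(1) by (simp only: mult_le_cancel_left_pos)
  then have "f x \<le> f b + s * (f b - f a)" by (simp add: algebra_simps)
  then have *: "t < s * ((f b - f a) - (f c - f b))" using lower by (simp add: ch algebra_simps)
  then have "0 < s * ((f b - f a) - (f c - f b))" using \<open>t > 0\<close> by linarith
  then have "0 < (f b - f a) - (f c - f b)" using s by (simp add: zero_less_mult_iff)
  then have "s * ((f b - f a) - (f c - f b)) \<le> 1 * ((f b - f a) - (f c - f b))"
    using s by (intro mult_right_mono) auto
  then show ?thesis using * by (simp add: abc)
qed

text \<open>An interval is exceptional if it meets \<open>{f > 0}\<close> but this set does not contain the
  interval together with its left neighbour. Convexity of \<open>{f > 0}\<close> allows at most three of them.\<close>

lemma card_deviates_le: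
  assumes f: "f \<in> trunc_concave" and "t > 0"
  shows "real (card {i. i < 2 ^ j \<and> deviates f j i t}) \<le> 7 / sqrt t"
proof (cases "t \<ge> 1")
  case True
  then show ?thesis using not_deviates_1[OF f True] \<open>t > 0\<close> by simp
next
  case False
  define X where "X = {i. i < 2 ^ j \<and> deviates f j i t}"
  define reg where "reg i \<longleftrightarrow> i \<ge> 1 \<and> (\<forall>x. dyadic j (i - 1) \<le> x \<longrightarrow> x \<le> dyadic j (Suc i) \<longrightarrow> 0 < f x)" for i
  define E where "E = {i \<in> X. \<not> reg i}"
  define G where "G = {i \<in> X. reg i}"
  have fin: "finite X" "finite E" "finite G" by (auto simp: X_def E_def G_def)
  have meets: "\<exists>x. dyadic j i \<le> x \<and> x \<le> dyadic j (Suc i) \<and> 0 < f x" if "i \<in> X" for i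
  proof (rule ccontr)
    assume "\<not> ?thesis"
    then have z: "f x = 0" if "dyadic j i \<le> x" "x \<le> dyadic j (Suc i)" for x
      using that trunc_concave_bounds(1)[OF f, of x] by force
    have "f (dyadic j i) = 0" "f (dyadic j (Suc i)) = 0" using z by (auto simp: dyadic_mono)
    then have "\<not> deviates f j i t" using z \<open>t > 0\<close> by (auto simp: deviates_def chord_def)
    then show False using that by (simp add: X_def)
  qed
  have "card E \<le> 3"
  proof (cases "E = {}")
    case False
    \<comment> \<open>For any other index, the interval and its left neighbour lie between two
      intervals meeting \<open>{f > 0}\<close>. \<open>Suc (Min E)\<close> escapes this argument
      because its left neighbour is the interval \<open>Min E\<close> itself.\<close>
    have "E \<subseteq> {Min E, Suc (Min E), Max E}"
    proof
      fix i assume i: "i \<in> E"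
      show "i \<in> {Min E, Suc (Min E), Max E}"
      proof (rule ccontr)
        assume ni: "i \<notin> {Min E, Suc (Min E), Max E}"
        have "Min E \<le> i" "i \<le> Max E" using i fin by auto
        then have le: "Suc (Min E) \<le> i - 1" "Suc i \<le> Max E" "i \<ge> 1" using ni by auto
        have "Min E \<in> X" "Max E \<in> X" using fin False Min_in[of E] Max_in[of E] by (auto simp: E_def)
        then obtain x y where x: "x \<le> dyadic j (Suc (Min E))" "0 < f x" and y: "dyadic j (Max E) \<le> y" "0 < f y"
          using meets by meson
        have "reg i"
          unfolding reg_def
        proof (intro conjI allI impI)
          fix z assume z: "dyadic j (i - 1) \<le> z" "z \<le> dyadic j (Suc i)"
          have "x \<le> z" "z \<le> y"
            using x y z dyadic_mono[OF le(1), of j] dyadic_mono[OF le(2), of j] by linarith+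
          then show "0 < f z" by (rule trunc_concave_pos[OF f x(2) y(2)])
        qed (use le in simp)
        then show False using i by (simp add: E_def)
      qed
    qed
    then have "card E \<le> card {Min E, Suc (Min E), Max E}" by (intro card_mono) auto
    also have "\<dots> \<le> 3" by (simp add: card_insert_if)
    finally show ?thesis .
  qed simp
  moreover have "real (card G) \<le> 1 + 2 * sqrt (2 / t)"
  proof (cases "G = {}")
    case False
    define y where "y i = f (dyadic j i)" for i
    define d where "d i = y (Suc i) - y i" for i
    \<comment> \<open>Regularity covers the left neighbour of \<open>Min G\<close> and the right end
      of \<open>Max G\<close>, so \<open>f\<close> is positive, hence the sequence concave, from p
      to Suc q.\<close>
    define p q where "p = Min G - 1" and "q = Max G"
    have mem: "Min G \<in> G" "Max G \<in> G" using fin False by auto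
    have ge1: "i \<ge> 1" if "i \<in> G" for i using that by (simp add: G_def reg_def)
    have pos: "0 < y i" if "p \<le> i" "i \<le> Suc q" for i
    proof -
      have "reg (Min G)" "reg (Max G)" using mem unfolding G_def by blast+
      then have "0 < f (dyadic j (Min G - 1))" "0 < f (dyadic j (Suc (Max G)))"
        unfolding reg_def by (meson dyadic_mono diff_le_self le_SucI order_refl order_trans)+
      then show ?thesis unfolding y_def
        by (rule trunc_concave_pos[OF f]) (use that in \<open>auto simp: p_def q_def dyadic_mono\<close>)
    qed
    have d_step: "d (Suc i) \<le> d i" if "p \<le> i" "Suc i \<le> q" for i
    proof -
      let ?\<eta> = "1 / 2 ^ j :: real"
      have "(dyadic j (Suc (Suc i)) - dyadic j (Suc i)) * f (dyadic j i)
          + (dyadic j (Suc i) - dyadic j i) * f (dyadic j (Suc (Suc i)))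
          \<le> (dyadic j (Suc (Suc i)) - dyadic j i) * f (dyadic j (Suc i))"
        by (rule trunc_concave_chord[OF f]) (use pos that in \<open>auto simp: y_def[symmetric] dyadic_mono\<close>)
      then have "?\<eta> * (y i + y (Suc (Suc i))) \<le> ?\<eta> * (2 * y (Suc i))"
        by (simp add: dyadic_Suc y_def algebra_simps)
      then have "y i + y (Suc (Suc i)) \<le> 2 * y (Suc i)" by (subst (asm) mult_le_cancel_left_pos) auto
      then show ?thesis by (simp add: d_def)
    qed
    show ?thesis
    proof (rule card_second_difference_le[where p = p and q = q and y = y and d = d])
      show "G \<subseteq> {p<..q}"
      proof
        fix i assume "i \<in> G"
        then have "Min G \<le> i" "i \<le> Max G" "Min G \<ge> 1" using fin ge1 mem by auto
        then show "i \<in> {p<..q}" by (auto simp: p_def q_def)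
      qed
      show "d k \<le> d i" if "p \<le> i" "i \<le> k" "k \<le> q" for i k
        using that(2,3)
      proof (induction k rule: dec_induct)
        case (step k)
        then show ?case using d_step[of k] that(1) by simp
      qed simp
      show "d (i - 1) - d i > t" if "i \<in> G" for i
        using deviates_regular[OF f _ \<open>t > 0\<close>, of j i] that
        by (auto simp: G_def X_def reg_def d_def y_def)
    qed (use fin \<open>t > 0\<close> trunc_concave_bounds[OF f] in \<open>auto simp: d_def y_def\<close>)
  qed (use \<open>t > 0\<close> in simp)
  moreover have "card X = card E + card G"
    using fin by (subst card_Un_disjoint[symmetric]) (auto simp: E_def G_def intro: arg_cong[where f = card])
  ultimately have "real (card X) \<le> 4 + 2 * sqrt (2 / t)" by simp
  also have "\<dots> \<le> 7 / sqrt t"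
  \<comment> \<open>The 4 collects three exceptional intervals and the lost drop. Since t < 1 it is
    absorbed into 1 / sqrt t, and 4 + 2 sqrt 2 \<le> 7.\<close>
  proof -
    have st: "0 < sqrt t" "sqrt t \<le> 1" using \<open>t > 0\<close> False by auto
    have "sqrt 2 \<le> 3 / (2::real)" by (rule real_le_lsqrt) (auto simp: power2_eq_square)
    then have "4 * sqrt t + 2 * sqrt 2 \<le> 7" using st by linarith
    then have "(4 * sqrt t + 2 * sqrt 2) / sqrt t \<le> 7 / sqrt t" using st by (intro divide_right_mono) auto
    then show ?thesis using st by (simp add: real_sqrt_divide add_divide_distrib)
  qed
  finally show ?thesis by (simp add: X_def)
qed

section \<open>Codes for adaptive dyadic approximations\<close>

text \<open>The splitting tree of a dyadic interval. The integer at a node corrects the midpoint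
  value against the mean of the end values, in units of the tolerance of that level.\<close>

datatype code = Leaf | Node int code code

text \<open>Decoder for the interval from \<open>dyadic j i\<close> to
  \<open>dyadic j (Suc i)\<close>: u and v stand for the approximate values at its ends, and a leaf
  interpolates between them.\<close>

fun centre :: "(nat \<Rightarrow> real) \<Rightarrow> nat \<Rightarrow> nat \<Rightarrow> real \<Rightarrow> real \<Rightarrow> code \<Rightarrow> real \<Rightarrow> real" where
  "centre \<delta> j i u v Leaf x = u + (v - u) * ((x - dyadic j i) * 2 ^ j)"
| "centre \<delta> j i u v (Node c s t) x =
     (let w = (u + v) / 2 + \<delta> j * of_int c in
      if x < dyadic (Suc j) (Suc (2 * i)) then centre \<delta> (Suc j) (2 * i) u w s x
      else centre \<delta> (Suc j) (Suc (2 * i)) w v t x)"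

text \<open>One \<delta> j pays for the deviation of \<open>f\<close> from its chord, the other for
  the errors of the end values.\<close>

fun radius :: "(nat \<Rightarrow> real) \<Rightarrow> nat \<Rightarrow> nat \<Rightarrow> code \<Rightarrow> real \<Rightarrow> real" where
  "radius \<delta> j i Leaf x = 2 * \<delta> j"
| "radius \<delta> j i (Node c s t) x =
     (if x < dyadic (Suc j) (Suc (2 * i)) then radius \<delta> (Suc j) (2 * i) s x
      else radius \<delta> (Suc j) (Suc (2 * i)) t x)"

fun leaves :: "code \<Rightarrow> nat" where
  "leaves Leaf = 1"
| "leaves (Node c s t) = leaves s + leaves t"

text \<open>Both signs together give 1 / ((m + 1) (m + 2)) for m = |c| > 0, which telescopes. Since
  the decay is only quadratic, the price of a label is logarithmic in its size.\<close>

definition label_weight :: "int \<Rightarrow> real" where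
  "label_weight c = 1 / (2 * (\<bar>of_int c\<bar> + 1) * (\<bar>of_int c\<bar> + 2))"

text \<open>Chosen to satisfy a Kraft inequality (\<open>sum_weight_codes\<close>), so that a lower bound on the
  weights of a set of codes bounds their number.\<close>

fun weight :: "code \<Rightarrow> real" where
  "weight Leaf = 1 / 4"
| "weight (Node c s t) = label_weight c * weight s * weight t"

text \<open>The bounds m on labels and n on depth make the set finite; the weight estimate below is
  uniform in both.\<close>

fun codes :: "nat \<Rightarrow> nat \<Rightarrow> code set" where
  "codes m 0 = {Leaf}"
| "codes m (Suc n) =
     insert Leaf ((\<lambda>(c, s, t). Node c s t) ` ({- int m..int m} \<times> codes m n \<times> codes m n))"

lemma label_weight_pos: "label_weight c > 0"
  by (auto simp: label_weight_def intro!: divide_pos_pos mult_pos_pos add_nonneg_pos)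

lemma weight_pos: "weight t > 0"
  by (induction t) (auto simp: label_weight_pos)

lemma finite_codes: "finite (codes m n)"
  by (induction n) auto

lemma sum_label_weight: "(\<Sum>c = - int m..int m. label_weight c) \<le> 1 - 1 / (real m + 2)"
proof (induction m)
  case (Suc m)
  have "{- int (Suc m)..int (Suc m)} = insert (int (Suc m)) (insert (- int (Suc m)) {- int m..int m})"
    by auto
  then have "(\<Sum>c = - int (Suc m)..int (Suc m). label_weight c)
      = 2 * label_weight (int (Suc m)) + (\<Sum>c = - int m..int m. label_weight c)"
    by (simp add: label_weight_def)
  also have "2 * label_weight (int (Suc m)) = 1 / ((real m + 2) * (real m + 3))"
    by (simp add: label_weight_def divide_simps) (simp add: algebra_simps)
  also have "\<dots> = 1 / (real m + 2) - 1 / (real m + 3)"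
    by (simp add: field_simps)
  finally show ?case using Suc by (simp add: add.commute)
qed (simp add: label_weight_def)

text \<open>A tree is a leaf or a label with two subtrees, so one more level turns a total W into at
  most 1/4 + W^2. The leaf weight 1/4 is the largest for which this recursion stays bounded, and 1/2
  is its fixed point.\<close>

lemma sum_weight_codes: "(\<Sum>t \<in> codes m n. weight t) \<le> 1 / 2"
proof (induction n)
  case (Suc n)
  let ?C = "{- int m..int m}" and ?T = "codes m n" and ?f = "\<lambda>(c, s, t). Node c s t"
  have nn: "0 \<le> (\<Sum>t \<in> ?T. weight t)" by (intro sum_nonneg) (simp add: weight_pos less_imp_le)
  have inj: "inj_on ?f (?C \<times> ?T \<times> ?T)" by (auto simp: inj_on_def)
  have "(\<Sum>t \<in> codes m (Suc n). weight t) = 1 / 4 + (\<Sum>t \<in> ?f ` (?C \<times> ?T \<times> ?T). weight t)"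
    using finite_codes[of m n] by (subst codes.simps, subst sum.insert) auto
  also have "(\<Sum>t \<in> ?f ` (?C \<times> ?T \<times> ?T). weight t)
      = (\<Sum>(c, s, t) \<in> ?C \<times> ?T \<times> ?T. label_weight c * (weight s * weight t))"
    by (subst sum.reindex[OF inj]) (auto intro!: sum.cong)
  also have "\<dots> = (\<Sum>c \<in> ?C. label_weight c) * ((\<Sum>t \<in> ?T. weight t) * (\<Sum>t \<in> ?T. weight t))"
    by (simp add: sum.cartesian_product[symmetric] sum_distrib_left[symmetric] sum_distrib_right[symmetric])
  also have "\<dots> \<le> 1 * (1 / 2 * (1 / 2))"
    using sum_label_weight[of m] Suc nn
    by (intro mult_mono) (auto intro: order_trans[OF sum_label_weight] mult_nonneg_nonneg)
  finally show ?case by simp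
qed simp

lemma card_codes_le:
  assumes "B \<subseteq> codes m n" "w > 0" "\<And>t. t \<in> B \<Longrightarrow> w \<le> weight t"
  shows "real (card B) \<le> 1 / w"
proof -
  have fin: "finite B" using assms(1) finite_codes finite_subset by blast
  have "real (card B) * w = (\<Sum>t \<in> B. w)" by simp
  also have "\<dots> \<le> (\<Sum>t \<in> B. weight t)" using assms(3) by (rule sum_mono)
  also have "\<dots> \<le> (\<Sum>t \<in> codes m n. weight t)"
    using assms(1) by (intro sum_mono2) (auto simp: finite_codes weight_pos less_imp_le)
  also have "\<dots> \<le> 1" using sum_weight_codes[of m n] by simp
  finally show ?thesis using \<open>w > 0\<close> by (simp add: field_simps)
qed

lemma borel_measurable_centre [measurable]: "centre \<delta> j i u v t \<in> borel_measurable borel"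
proof (induction t arbitrary: j i u v)
  case (Node c s t)
  note [measurable] = Node
  show ?case unfolding centre.simps[abs_def] Let_def by measurable
qed (unfold centre.simps[abs_def], measurable)

lemma borel_measurable_radius [measurable]: "radius \<delta> j i t \<in> borel_measurable borel"
proof (induction t arbitrary: j i)
  case (Node c s t)
  note [measurable] = Node
  show ?case unfolding radius.simps[abs_def] by measurable
qed (unfold radius.simps[abs_def], measurable)

section \<open>Encoding, decoding and the approximation error\<close>

lemma dyadic_double: "dyadic (Suc j) (2 * i) = dyadic j i"
  by (simp add: dyadic_def)

lemma dyadic_double_Suc: "dyadic (Suc j) (Suc (Suc (2 * i))) = dyadic j (Suc i)"
  using dyadic_double[of j "Suc i"] by simp

lemma dyadic_less_Suc: "dyadic j i < dyadic j (Suc i)"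
  by (simp add: dyadic_Suc)

text \<open>A leaf of level j contributes (4 \<delta> j)^r 2^-j, which the assumed growth of
  \<delta> j makes equal to \<open>4 powr r * \<kappa>\<close> at every level; so the integral
  merely counts leaves. The 4 is twice the radius factor 2.\<close>

lemma nn_integral_radius:
  assumes "r > 0" "\<And>j. \<delta> j > 0" "\<And>j. \<delta> j powr r = \<kappa> * 2 ^ j" "\<kappa> \<ge> 0"
  shows "(\<integral>\<^sup>+x. ennreal ((2 * radius \<delta> j i t x) powr r) * indicator {dyadic j i..<dyadic j (Suc i)} x \<partial>lborel)
       = ennreal (real (leaves t) * (4 powr r * \<kappa>))"
proof (induction t arbitrary: j i)
  case Leaf
  have "(4 * \<delta> j) powr r / 2 ^ j = 4 powr r * \<kappa>"
    using assms(2)[of j] by (simp add: powr_mult assms(3) less_imp_le)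
  then show ?case
    by (simp add: nn_integral_cmult_indicator dyadic_less_Suc less_imp_le dyadic_Suc ennreal_mult[symmetric])
next
  case (Node c s t)
  let ?m = "dyadic (Suc j) (Suc (2 * i))"
  have ab: "dyadic j i < ?m" "?m < dyadic j (Suc i)"
    using dyadic_less_Suc[of "Suc j" "2 * i"] dyadic_less_Suc[of "Suc j" "Suc (2 * i)"]
    by (simp_all add: dyadic_double dyadic_double_Suc)
  have "(\<integral>\<^sup>+x. ennreal ((2 * radius \<delta> j i (Node c s t) x) powr r) * indicator {dyadic j i..<dyadic j (Suc i)} x \<partial>lborel)
      = (\<integral>\<^sup>+x. (ennreal ((2 * radius \<delta> (Suc j) (2 * i) s x) powr r) * indicator {dyadic (Suc j) (2 * i)..<?m} x
           + ennreal ((2 * radius \<delta> (Suc j) (Suc (2 * i)) t x) powr r)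
              * indicator {?m..<dyadic (Suc j) (Suc (Suc (2 * i)))} x) \<partial>lborel)"
    using ab by (intro nn_integral_cong) (auto simp: dyadic_double dyadic_double_Suc split: split_indicator)
  also have "\<dots> = ennreal (real (leaves s) * (4 powr r * \<kappa>)) + ennreal (real (leaves t) * (4 powr r * \<kappa>))"
    by (subst nn_integral_add) (auto simp: Node.IH)
  finally show ?case using assms(4) by (simp add: ennreal_plus[symmetric] algebra_simps del: ennreal_plus)
qed

text \<open>The label is rounded against the decoded end values u and v, not against the true values
  of \<open>f\<close>, so rounding errors do not accumulate along a branch. The third argument caps
  the depth.\<close>

fun encode :: "(real \<Rightarrow> real) \<Rightarrow> (nat \<Rightarrow> real) \<Rightarrow> nat \<Rightarrow> nat \<Rightarrow> nat \<Rightarrow> real \<Rightarrow> real \<Rightarrow> code" where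
  "encode f \<delta> 0 j i u v = Leaf"
| "encode f \<delta> (Suc n) j i u v =
     (if deviates f j i (\<delta> j) then
        let c = round ((f (dyadic (Suc j) (Suc (2 * i))) - (u + v) / 2) / \<delta> j);
            w = (u + v) / 2 + \<delta> j * of_int c
        in Node c (encode f \<delta> n (Suc j) (2 * i) u w) (encode f \<delta> n (Suc j) (Suc (2 * i)) w v)
      else Leaf)"

lemma round_step_error:
  assumes "(\<delta>::real) > 0"
  shows "\<bar>z + \<delta> * of_int (round ((y - z) / \<delta>)) - y\<bar> \<le> \<delta> / 2"
proof -
  have "\<bar>of_int (round ((y - z) / \<delta>)) - (y - z) / \<delta>\<bar> \<le> 1 / 2"
    by (rule of_int_round_abs_le)
  then have "\<delta> * \<bar>of_int (round ((y - z) / \<delta>)) - (y - z) / \<delta>\<bar> \<le> \<delta> * (1 / 2)"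
    using assms by (intro mult_left_mono) auto
  moreover have "\<delta> * \<bar>of_int (round ((y - z) / \<delta>)) - (y - z) / \<delta>\<bar>
      = \<bar>\<delta> * (of_int (round ((y - z) / \<delta>)) - (y - z) / \<delta>)\<bar>"
    using assms by (simp add: abs_mult)
  moreover have "\<delta> * (of_int (round ((y - z) / \<delta>)) - (y - z) / \<delta>) = z + \<delta> * of_int (round ((y - z) / \<delta>)) - y"
    using assms by (simp add: field_simps)
  ultimately show ?thesis by simp
qed

text \<open>Invariant: the end values are known up to \<delta> j. A new midpoint is rounded to
  within \<delta> j / 2, old ends keep their error, and both fit the larger \<delta> (Suc j). When
  the depth cap is reached the tolerance is at least 1, so nothing deviates and stopping is
  legitimate.\<close>

lemma abs_diff_centre_le:
  assumes f: "f \<in> trunc_concave" and pos: "\<And>j. \<delta> j > 0" and mono: "\<And>j. \<delta> j \<le> \<delta> (Suc j)"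
    and "\<delta> (j + n) \<ge> 1"
    and "\<bar>u - f (dyadic j i)\<bar> \<le> \<delta> j" "\<bar>v - f (dyadic j (Suc i))\<bar> \<le> \<delta> j"
    and "dyadic j i \<le> x" "x < dyadic j (Suc i)"
  shows "\<bar>f x - centre \<delta> j i u v (encode f \<delta> n j i u v) x\<bar> \<le> radius \<delta> j i (encode f \<delta> n j i u v) x"
  using assms(4-)
proof (induction n arbitrary: j i u v)
  have leaf: "\<bar>f x - centre \<delta> j i u v Leaf x\<bar> \<le> radius \<delta> j i Leaf x"
    if "\<not> deviates f j i (\<delta> j)" "\<bar>u - f (dyadic j i)\<bar> \<le> \<delta> j" "\<bar>v - f (dyadic j (Suc i))\<bar> \<le> \<delta> j"
      "dyadic j i \<le> x" "x < dyadic j (Suc i)" for j i u v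
  proof -
    define s where "s = (x - dyadic j i) * 2 ^ j"
    have s: "0 \<le> s" "s \<le> 1" using that(4,5) by (auto simp: s_def dyadic_Suc field_simps)
    have "\<bar>f x - chord f (dyadic j i) (dyadic j (Suc i)) x\<bar> \<le> \<delta> j"
      using that by (auto simp: deviates_def not_less)
    moreover have "chord f (dyadic j i) (dyadic j (Suc i)) x - centre \<delta> j i u v Leaf x
        = (1 - s) * (f (dyadic j i) - u) + s * (f (dyadic j (Suc i)) - v)"
      by (simp add: chord_def dyadic_Suc s_def algebra_simps)
    moreover have "\<bar>(1 - s) * (f (dyadic j i) - u) + s * (f (dyadic j (Suc i)) - v)\<bar>
        \<le> (1 - s) * \<delta> j + s * \<delta> j"
    proof -
      have "\<bar>(1 - s) * (f (dyadic j i) - u)\<bar> \<le> (1 - s) * \<delta> j" "\<bar>s * (f (dyadic j (Suc i)) - v)\<bar> \<le> s * \<delta> j"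
        using s that(2,3) by (auto simp: abs_mult abs_minus_commute intro!: mult_left_mono)
      then show ?thesis by linarith
    qed
    ultimately show ?thesis by (simp add: algebra_simps) 
  qed
  {
    case 0
    then show ?case using leaf[of j i u v] not_deviates_1[OF f, of "\<delta> j"] by simp
  next
    case (Suc n)
    show ?case
    proof (cases "deviates f j i (\<delta> j)")
      case True
      define c where "c = round ((f (dyadic (Suc j) (Suc (2 * i))) - (u + v) / 2) / \<delta> j)"
      define w where "w = (u + v) / 2 + \<delta> j * of_int c"
      have enc: "encode f \<delta> (Suc n) j i u v
          = Node c (encode f \<delta> n (Suc j) (2 * i) u w) (encode f \<delta> n (Suc j) (Suc (2 * i)) w v)"
        using True by (simp add: c_def[symmetric] w_def[symmetric] Let_def)
      have "\<bar>w - f (dyadic (Suc j) (Suc (2 * i)))\<bar> \<le> \<delta> j / 2"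
        unfolding w_def c_def by (rule round_step_error[OF pos])
      then have w: "\<bar>w - f (dyadic (Suc j) (Suc (2 * i)))\<bar> \<le> \<delta> (Suc j)"
        using pos[of j] mono[of j] by linarith
      have uv: "\<bar>u - f (dyadic (Suc j) (2 * i))\<bar> \<le> \<delta> (Suc j)"
        "\<bar>v - f (dyadic (Suc j) (Suc (Suc (2 * i))))\<bar> \<le> \<delta> (Suc j)"
        unfolding dyadic_double dyadic_double_Suc using Suc.prems(2,3) mono[of j] by linarith+
      show ?thesis
      proof (cases "x < dyadic (Suc j) (Suc (2 * i))")
        case True
        then show ?thesis unfolding enc centre.simps radius.simps Let_def w_def[symmetric]
          using Suc.IH[of "Suc j" u "2 * i" w] Suc.prems w uv by (simp add: dyadic_double)
      next
        case False
        then show ?thesis unfolding enc centre.simps radius.simps Let_def w_def[symmetric]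
          using Suc.IH[of "Suc j" w "Suc (2 * i)" v] Suc.prems w uv by (simp add: dyadic_double_Suc)
      qed
    next
      case False
      then show ?thesis using leaf[of j i u v] Suc.prems by simp
    qed
  }
qed

section \<open>Counting codes\<close>

text \<open>Up to the cap N, this is the number of doublings that lift the tolerance to the
  deviation, hence the logarithmic size of the label. As a count over thresholds it can be summed in
  the other order, threshold by threshold.\<close>

definition excess_count :: "(real \<Rightarrow> real) \<Rightarrow> (nat \<Rightarrow> real) \<Rightarrow> nat \<Rightarrow> nat \<Rightarrow> nat \<Rightarrow> nat" where
  "excess_count f \<delta> N j i = card {k. k < N \<and> deviates f j i (\<delta> j * 2 ^ k)}"

text \<open>The indices \<open>i'\<close> are the descendants of interval i at level j + k. All of
  them are counted, whether or not the splitting tree reaches them.\<close>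

definition total_excess :: "(real \<Rightarrow> real) \<Rightarrow> (nat \<Rightarrow> real) \<Rightarrow> nat \<Rightarrow> nat \<Rightarrow> nat \<Rightarrow> nat \<Rightarrow> nat" where
  "total_excess f \<delta> N n j i =
     (\<Sum>k<n. \<Sum>i' \<in> {i * 2 ^ k..<Suc i * 2 ^ k}. excess_count f \<delta> N (j + k) i')"

lemma total_excess_Suc:
  "total_excess f \<delta> N (Suc n) j i = excess_count f \<delta> N j i
     + total_excess f \<delta> N n (Suc j) (2 * i) + total_excess f \<delta> N n (Suc j) (Suc (2 * i))"
proof -
  have split: "(\<Sum>i' \<in> {i * 2 ^ Suc k..<Suc i * 2 ^ Suc k}. g i')
      = (\<Sum>i' \<in> {2 * i * 2 ^ k..<Suc (2 * i) * 2 ^ k}. g i')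
        + (\<Sum>i' \<in> {Suc (2 * i) * 2 ^ k..<Suc (Suc (2 * i)) * 2 ^ k}. g i')" for k and g :: "nat \<Rightarrow> nat"
    by (subst sum.atLeastLessThan_concat) (simp_all add: algebra_simps)
  show ?thesis
    unfolding total_excess_def sum.lessThan_Suc_shift split sum.distrib
    by (simp add: algebra_simps)
qed

lemma deviates_antimono: "deviates f j i t \<Longrightarrow> s \<le> t \<Longrightarrow> deviates f j i s"
  by (auto simp: deviates_def intro: less_le_trans order_le_less_trans)

text \<open>Exceeding the threshold with exponent c < N means exceeding those with exponents 0, ...,
  c, which are c + 1 and not c. For c = N the threshold is already at least 1.\<close>

lemma not_deviates_excess:
  assumes "f \<in> trunc_concave" "\<delta> j > 0" "\<delta> j * 2 ^ N \<ge> 1"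
  shows "\<not> deviates f j i (\<delta> j * 2 ^ excess_count f \<delta> N j i)"
proof
  let ?c = "excess_count f \<delta> N j i"
  let ?K = "{k. k < N \<and> deviates f j i (\<delta> j * 2 ^ k)}"
  assume dev: "deviates f j i (\<delta> j * 2 ^ ?c)"
  show False
  proof (cases "?c < N")
    case True
    have "{..?c} \<subseteq> ?K"
      using True assms(2) by (auto intro!: deviates_antimono[OF dev] mult_left_mono)
    then have "card {..?c} \<le> card ?K" by (intro card_mono) auto
    then show False by (simp add: excess_count_def)
  next
    case False
    then have "\<delta> j * 2 ^ N \<le> \<delta> j * 2 ^ ?c" using assms(2) by (intro mult_left_mono) auto
    then show False using dev not_deviates_1[OF assms(1)] assms(3) by (meson order_trans)
  qed
qed

lemma chord_mid: "chord f (dyadic j i) (dyadic j (Suc i)) (dyadic (Suc j) (Suc (2 * i)))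
    = (f (dyadic j i) + f (dyadic j (Suc i))) / 2"
proof -
  have "(dyadic (Suc j) (Suc (2 * i)) - dyadic j i) / (dyadic j (Suc i) - dyadic j i) = 1 / 2"
    by (simp add: dyadic_def field_simps)
  then show ?thesis by (simp only: chord_def) (simp add: field_simps)
qed

text \<open>In units of \<delta> j, the midpoint is off the chord by at most 2^x for x =
  \<open>excess_count f \<delta> N j i\<close>, the end values add 1 and rounding adds 1/2. Thus |c|
  + 2 \<le> 2^x + 7/2, which 5 times 2^x covers.\<close>

lemma label_bound:
  assumes f: "f \<in> trunc_concave" and pos: "\<delta> j > 0" "\<delta> j * 2 ^ N \<ge> 1"
    and "\<bar>u - f (dyadic j i)\<bar> \<le> \<delta> j" "\<bar>v - f (dyadic j (Suc i))\<bar> \<le> \<delta> j"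
    and c: "c = round ((f (dyadic (Suc j) (Suc (2 * i))) - (u + v) / 2) / \<delta> j)"
  shows "\<bar>real_of_int c\<bar> + 2 \<le> 5 * 2 ^ excess_count f \<delta> N j i"
proof -
  let ?m = "dyadic (Suc j) (Suc (2 * i))" and ?n = "excess_count f \<delta> N j i"
  have m: "?m \<in> {dyadic j i..dyadic j (Suc i)}"
    by (auto simp: dyadic_def field_simps)
  have "\<bar>f ?m - (f (dyadic j i) + f (dyadic j (Suc i))) / 2\<bar> \<le> \<delta> j * 2 ^ ?n"
    using not_deviates_excess[of f \<delta> j N i, OF f pos] m unfolding deviates_def chord_mid[symmetric]
    by (meson not_less)
  moreover have "\<bar>(u + v) / 2 + \<delta> j * of_int c - f ?m\<bar> \<le> \<delta> j / 2"
    unfolding c by (rule round_step_error[OF pos(1)])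
  ultimately have "\<bar>\<delta> j * of_int c\<bar> \<le> \<delta> j * 2 ^ ?n + \<delta> j + \<delta> j / 2"
    using assms(4,5) by (simp only: abs_le_iff) (simp add: field_simps)
  then have "\<delta> j * \<bar>real_of_int c\<bar> \<le> \<delta> j * (2 ^ ?n + 3 / 2)"
    using pos by (simp add: abs_mult algebra_simps)
  then have "\<bar>real_of_int c\<bar> \<le> 2 ^ ?n + 3 / 2" using pos by (simp only: mult_le_cancel_left_pos)
  moreover have "(1::real) \<le> 2 ^ ?n" by simp
  ultimately show ?thesis by linarith
qed

text \<open>800 is 8 * 25 * 4, with the constants moved under the power by n \<ge> 1. The division
  by 4 is the cost of joining two subtrees: their two leaf factors 1/4 have to become one.\<close>

lemma label_weight_bound:
  assumes "\<bar>real_of_int c\<bar> + 2 \<le> 5 * 2 ^ n" "n \<ge> 1"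
  shows "label_weight c / 4 \<ge> (1 / 800) ^ n"
proof -
  let ?a = "\<bar>real_of_int c\<bar>"
  have "(?a + 1) * (?a + 2) \<le> (5 * 2 ^ n) * (5 * 2 ^ n)"
    using assms by (intro mult_mono) auto
  also have "\<dots> = 25 * 4 ^ n" by (simp add: power_mult_distrib[symmetric])
  finally have "8 * ((?a + 1) * (?a + 2)) \<le> 200 * 4 ^ n" by simp
  also have "\<dots> \<le> 200 ^ n * 4 ^ n"
    using power_increasing[of 1 n "200::real"] assms(2) by (intro mult_right_mono) auto
  also have "\<dots> = 800 ^ n" by (simp add: power_mult_distrib[symmetric])
  finally have "1 / 800 ^ n \<le> 1 / (8 * ((?a + 1) * (?a + 2)))"
    by (intro divide_left_mono) (auto intro!: mult_pos_pos add_nonneg_pos)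
  moreover have "label_weight c / 4 = 1 / (8 * ((?a + 1) * (?a + 2)))"
    unfolding label_weight_def divide_divide_eq_left by (rule arg_cong[where f = "(/) 1"]) (simp add: algebra_simps)
  ultimately show ?thesis by (simp only: power_divide power_one)
qed

text \<open>Every split interval deviates beyond \<delta> j, so its excess is at least 1 and pays
  both for its label and for the additional leaf.\<close>

lemma encode_bounds:
  assumes f: "f \<in> trunc_concave" and pos: "\<And>j. \<delta> j > 0" and mono: "\<And>j. \<delta> j \<le> \<delta> (Suc j)"
    and N: "\<And>j. \<delta> j * 2 ^ N \<ge> 1" "N \<ge> 1"
    and "\<bar>u - f (dyadic j i)\<bar> \<le> \<delta> j" "\<bar>v - f (dyadic j (Suc i))\<bar> \<le> \<delta> j"
  shows "encode f \<delta> n j i u v \<in> codes (5 * 2 ^ N) n \<and>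
    weight (encode f \<delta> n j i u v) \<ge> 1 / 4 * (1 / 800) ^ total_excess f \<delta> N n j i \<and>
    leaves (encode f \<delta> n j i u v) \<le> 1 + total_excess f \<delta> N n j i"
  using assms(6,7)
proof (induction n arbitrary: j i u v)
  case 0
  then show ?case by (simp add: total_excess_def)
next
  case (Suc n)
  show ?case
  proof (cases "deviates f j i (\<delta> j)")
    case True
    let ?x = "excess_count f \<delta> N j i"
    define c where "c = round ((f (dyadic (Suc j) (Suc (2 * i))) - (u + v) / 2) / \<delta> j)"
    define w where "w = (u + v) / 2 + \<delta> j * of_int c"
    define s where "s = encode f \<delta> n (Suc j) (2 * i) u w"
    define t where "t = encode f \<delta> n (Suc j) (Suc (2 * i)) w v"
    have enc: "encode f \<delta> (Suc n) j i u v = Node c s t"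
      using True by (simp add: c_def[symmetric] w_def[symmetric] s_def t_def Let_def)
    have "\<bar>w - f (dyadic (Suc j) (Suc (2 * i)))\<bar> \<le> \<delta> j / 2"
      unfolding w_def c_def by (rule round_step_error[OF pos])
    then have w: "\<bar>w - f (dyadic (Suc j) (Suc (2 * i)))\<bar> \<le> \<delta> (Suc j)"
      using pos[of j] mono[of j] by linarith
    have uv: "\<bar>u - f (dyadic (Suc j) (2 * i))\<bar> \<le> \<delta> (Suc j)"
      "\<bar>v - f (dyadic (Suc j) (Suc (Suc (2 * i))))\<bar> \<le> \<delta> (Suc j)"
      unfolding dyadic_double dyadic_double_Suc using Suc.prems mono[of j] by linarith+
    note IH = Suc.IH[OF uv(1) w, folded s_def] Suc.IH[OF w uv(2), folded t_def]
    have x: "?x \<ge> 1"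
    proof -
      have "{0} \<subseteq> {k. k < N \<and> deviates f j i (\<delta> j * 2 ^ k)}" using True N(2) by auto
      then have "card {0::nat} \<le> ?x" unfolding excess_count_def by (intro card_mono) auto
      then show ?thesis by simp
    qed
    have lb: "\<bar>real_of_int c\<bar> + 2 \<le> 5 * 2 ^ ?x"
      by (rule label_bound[of f \<delta> j N u i v c, OF f pos N(1) Suc.prems c_def])
    have "?x \<le> card {..<N}" unfolding excess_count_def by (intro card_mono) auto
    then have "(2::real) ^ ?x \<le> 2 ^ N" by (intro power_increasing) auto
    then have "5 * 2 ^ ?x \<le> (5 * 2 ^ N :: real)" by simp
    then have "\<bar>real_of_int c\<bar> \<le> 5 * 2 ^ N" using lb by linarith
    then have "\<bar>real_of_int c\<bar> \<le> real (5 * 2 ^ N)" by simp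
    then have "real_of_int \<bar>c\<bar> \<le> real_of_int (int (5 * 2 ^ N))" by simp
    then have "\<bar>c\<bar> \<le> int (5 * 2 ^ N)" by (simp only: of_int_le_iff)
    then have c: "c \<in> {- int (5 * 2 ^ N)..int (5 * 2 ^ N)}"
      unfolding atLeastAtMost_iff by linarith
    have "Node c s t \<in> codes (5 * 2 ^ N) (Suc n)"
      using c IH by (force simp: image_iff)
    moreover have "weight (Node c s t) \<ge> 1 / 4 * (1 / 800) ^ total_excess f \<delta> N (Suc n) j i"
    proof -
      have "1 / 4 * (1 / 800) ^ total_excess f \<delta> N (Suc n) j i
          = (4 * (1 / 800) ^ ?x) * ((1 / 4 * (1 / 800) ^ total_excess f \<delta> N n (Suc j) (2 * i))
              * (1 / 4 * (1 / 800) ^ total_excess f \<delta> N n (Suc j) (Suc (2 * i))) :: real)"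
        by (simp add: total_excess_Suc power_add)
      also have "\<dots> \<le> label_weight c * (weight s * weight t)"
        using IH label_weight_bound[OF lb x] label_weight_pos[of c] weight_pos[of s] weight_pos[of t]
        by (intro mult_mono) auto
      finally show ?thesis by (simp add: mult.assoc)
    qed
    moreover have "leaves (Node c s t) \<le> 1 + total_excess f \<delta> N (Suc n) j i"
      using IH x by (simp add: total_excess_Suc)
    ultimately show ?thesis unfolding enc by blast
  next
    case False
    have "(1 / 800 :: real) ^ total_excess f \<delta> N (Suc n) j i \<le> 1"
      by (intro power_le_one) auto
    then show ?thesis using False by simp
  qed
qed

section \<open>The total excess at the chosen tolerance\<close>

lemma sum_geometric_le: "0 \<le> q \<Longrightarrow> q < 1 \<Longrightarrow> (\<Sum>k<n. q ^ k) \<le> 1 / (1 - q :: real)"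
  by (simp add: sum_gp_strict divide_right_mono)

lemma sum_geometric_two_sided_le:
  assumes "0 < q" "q < (1::real)"
  shows "(\<Sum>j<n. q powr \<bar>real j - real j0\<bar>) \<le> 2 / (1 - q)"
proof -
  have "(\<Sum>j<n. q powr \<bar>real j - real j0\<bar>) \<le> (\<Sum>j<j0 + n. q powr \<bar>real j - real j0\<bar>)"
    by (intro sum_mono2) auto
  also have "\<dots> = (\<Sum>j<j0. q powr \<bar>real j - real j0\<bar>) + (\<Sum>j \<in> {j0..<j0 + n}. q powr \<bar>real j - real j0\<bar>)"
    unfolding lessThan_atLeast0 by (rule sum.atLeastLessThan_concat[symmetric]) auto
  also have "(\<Sum>j<j0. q powr \<bar>real j - real j0\<bar>) = (\<Sum>k<j0. q ^ Suc k)"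
    by (rule sum.reindex_bij_witness[of _ "\<lambda>k. j0 - Suc k" "\<lambda>k. j0 - Suc k"])
      (use assms in \<open>auto simp: powr_realpow[symmetric] of_nat_diff abs_if simp del: power_Suc\<close>)
  also have "\<dots> \<le> 1 / (1 - q)"
  proof -
    have "(\<Sum>k<j0. q ^ Suc k) \<le> (\<Sum>k<j0. q ^ k)"
      using assms by (intro sum_mono power_decreasing) auto
    then show ?thesis using sum_geometric_le[of q j0] assms by linarith
  qed
  also have "(\<Sum>j \<in> {j0..<j0 + n}. q powr \<bar>real j - real j0\<bar>) = (\<Sum>k<n. q ^ k)"
    by (rule sum.reindex_bij_witness[of _ "\<lambda>k. j0 + k" "\<lambda>k. k - j0"])
      (use assms in \<open>auto simp: powr_realpow[symmetric] of_nat_diff\<close>)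
  also have "\<dots> \<le> 1 / (1 - q)" using assms by (intro sum_geometric_le) auto
  finally show ?thesis by simp
qed

text \<open>The tolerance on an interval of length \<open>2 ^ -j\<close> makes every leaf contribute the same amount
  to the \<open>L\<^sub>r\<close> error; at level \<open>j0\<close> it equals \<open>4 ^ -j0\<close>.\<close>

definition tolerance :: "real \<Rightarrow> nat \<Rightarrow> nat \<Rightarrow> real" where
  "tolerance r j0 j = 2 powr ((real j - real j0) / r - 2 * real j0)"

text \<open>At fine levels, j \<ge> j0, the growing tolerance in \<open>card_deviates_le\<close>
  gives the decay. At coarse levels that bound grows away from j0, so it is combined with the
  trivial count 2^j by a geometric mean. This halves the exponents, whence the 1/4 in k and in the
  rate.\<close>

lemma card_deviates_tolerance_le:
  assumes f: "f \<in> trunc_concave" and "r \<ge> 1"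
  shows "real (card {i. i < 2 ^ j \<and> deviates f j i (tolerance r j0 j * 2 ^ k)})
     \<le> 7 * 2 ^ j0 * (2 powr (- 1 / 4)) ^ k * (2 powr (- min (1 / 4) (1 / (2 * r)))) powr \<bar>real j - real j0\<bar>"
proof -
  define s where "s = min (1 / 4) (1 / (2 * r))"
  have s: "0 < s" "s \<le> 1 / 4" "s \<le> 1 / (2 * r)" using \<open>r \<ge> 1\<close> by (auto simp: s_def)
  define x where "x = real j - real j0"
  let ?c = "real (card {i. i < 2 ^ j \<and> deviates f j i (tolerance r j0 j * 2 ^ k)})"
  have "card {i. i < 2 ^ j \<and> deviates f j i (tolerance r j0 j * 2 ^ k)} \<le> card {..<(2::nat) ^ j}"
    by (intro card_mono) auto
  then have c1: "?c \<le> 2 powr real j" by (simp add: powr_realpow)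
  have e: "tolerance r j0 j * 2 ^ k = 2 powr (x / r - 2 * real j0 + real k)"
    by (simp add: tolerance_def x_def powr_add powr_realpow)
  have "?c \<le> 7 / sqrt (tolerance r j0 j * 2 ^ k)"
    by (rule card_deviates_le[OF f]) (simp add: e)
  also have "sqrt (tolerance r j0 j * 2 ^ k) = 2 powr ((x / r - 2 * real j0 + real k) / 2)"
    unfolding e by (simp add: powr_half_sqrt[symmetric] powr_powr)
  also have "7 / \<dots> = 7 * 2 powr (- ((x / r - 2 * real j0 + real k) / 2))"
    by (simp add: powr_minus_divide)
  also have "- ((x / r - 2 * real j0 + real k) / 2) = real j0 - x / (2 * r) - real k / 2"
    by (simp add: field_simps)
  finally have c2: "?c \<le> 7 * 2 powr (real j0 - x / (2 * r) - real k / 2)" .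
  have "?c \<le> 7 * 2 powr (real j0 - s * \<bar>x\<bar> - real k / 4)"
  proof (cases "x \<ge> 0")
    case True
    have "s * x \<le> 1 / (2 * r) * x" using s True by (intro mult_right_mono) auto
    then have "real j0 - x / (2 * r) - real k / 2 \<le> real j0 - s * \<bar>x\<bar> - real k / 4" using True by simp
    then have "2 powr (real j0 - x / (2 * r) - real k / 2) \<le> 2 powr (real j0 - s * \<bar>x\<bar> - real k / 4)"
      by (intro powr_mono) auto
    then show ?thesis using c2 by linarith
  next
    case False
    have "?c * ?c \<le> 2 powr real j * (7 * 2 powr (real j0 - x / (2 * r) - real k / 2))"
      using c1 c2 by (intro mult_mono) auto
    also have "\<dots> = 7 * 2 powr (real j + (real j0 - x / (2 * r) - real k / 2))"
      by (simp only: powr_add)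
    also have "\<dots> \<le> 49 * 2 powr (2 * (real j0 - s * \<bar>x\<bar> - real k / 4))"
    proof (intro mult_mono powr_mono)
      define z w where "z = x / (2 * r)" and "w = s * \<bar>x\<bar>"
      have "- x * (1 / (2 * r)) \<le> - x * (1 / 2)"
        using \<open>r \<ge> 1\<close> False by (intro mult_left_mono) (auto simp: field_simps)
      then have "- z \<le> - x / 2" by (simp add: z_def)
      moreover have "s * - x \<le> 1 / 4 * - x" using s False by (intro mult_right_mono) auto
      then have "w \<le> - x / 4" using False by (simp add: w_def)
      ultimately have "real j + (real j0 - z - real k / 2) \<le> 2 * (real j0 - w - real k / 4)"
        unfolding x_def by (simp add: field_simps)
      then show "real j + (real j0 - x / (2 * r) - real k / 2) \<le> 2 * (real j0 - s * \<bar>x\<bar> - real k / 4)"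
        by (simp only: z_def w_def)
    qed auto
    also have "\<dots> = (7 * 2 powr (real j0 - s * \<bar>x\<bar> - real k / 4)) * (7 * 2 powr (real j0 - s * \<bar>x\<bar> - real k / 4))"
      by (simp add: powr_add[symmetric] algebra_simps)
    finally have "?c\<^sup>2 \<le> (7 * 2 powr (real j0 - s * \<bar>x\<bar> - real k / 4))\<^sup>2" by (simp only: power2_eq_square)
    then show ?thesis by (rule power2_le_imp_le) simp
  qed
  also have "7 * 2 powr (real j0 - s * \<bar>x\<bar> - real k / 4) = 7 * 2 ^ j0 * (2 powr (- 1 / 4)) ^ k * (2 powr (- s)) powr \<bar>x\<bar>"
  proof -
    have "2 ^ j0 = 2 powr real j0" "(2 powr (- 1 / 4)) ^ k = 2 powr (- real k / 4)"
      "(2 powr (- s)) powr \<bar>x\<bar> = 2 powr (- (s * \<bar>x\<bar>))"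
      by (simp_all add: powr_realpow[symmetric] powr_powr)
    then show ?thesis by (simp add: powr_add[symmetric] mult.assoc algebra_simps)
  qed
  finally show ?thesis by (simp add: s_def x_def)
qed

text \<open>Exchanging the sum over thresholds with the count of intervals leaves a geometric series
  in k and a two-sided one in j around j0. Both are bounded independently of n and N, so no
  logarithmic factor arises.\<close>

lemma total_excess_tolerance_le:
  assumes "r \<ge> 1"
  obtains K where "K > 0"
    "\<And>f N n j0. f \<in> trunc_concave \<Longrightarrow> real (total_excess f (tolerance r j0) N n 0 0) \<le> K * 2 ^ j0"
proof -
  define a :: real where "a = 2 powr (- 1 / 4)"
  define q :: real where "q = 2 powr (- min (1 / 4) (1 / (2 * r)))"
  have "2 powr (- 1 / 4) < 2 powr (0::real)" by (rule powr_less_mono) auto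
  then have a: "0 < a" "a < 1" by (auto simp: a_def)
  have "2 powr (- min (1 / 4) (1 / (2 * r))) < 2 powr 0" using \<open>r \<ge> 1\<close> by (intro powr_less_mono) auto
  then have q: "0 < q" "q < 1" by (auto simp: q_def)
  show thesis
  proof (rule that)
    show "7 * (1 / (1 - a)) * (2 / (1 - q)) > 0" using a q by (auto intro!: mult_pos_pos)
    fix f N n j0 assume f: "f \<in> trunc_concave"
    let ?D = "\<lambda>j i k. deviates f j i (tolerance r j0 j * 2 ^ k)"
    have "total_excess f (tolerance r j0) N n 0 0 = (\<Sum>j<n. \<Sum>i<2 ^ j. card {k. k < N \<and> ?D j i k})"
      by (simp add: total_excess_def excess_count_def lessThan_atLeast0)
    also have "\<dots> = (\<Sum>j<n. \<Sum>k<N. card {i. i < 2 ^ j \<and> ?D j i k})"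
    proof (rule sum.cong[OF refl])
      fix j
      have "(\<Sum>i<2 ^ j. card {k \<in> {..<N}. ?D j i k}) = (\<Sum>k<N. card {i \<in> {..<2 ^ j}. ?D j i k})"
        by (rule sum_multicount_gen) auto
      then show "(\<Sum>i<2 ^ j. card {k. k < N \<and> ?D j i k}) = (\<Sum>k<N. card {i. i < 2 ^ j \<and> ?D j i k})"
        by simp
    qed
    finally have "real (total_excess f (tolerance r j0) N n 0 0)
        = (\<Sum>j<n. \<Sum>k<N. real (card {i. i < 2 ^ j \<and> ?D j i k}))" by simp
    also have "\<dots> \<le> (\<Sum>j<n. \<Sum>k<N. 7 * 2 ^ j0 * a ^ k * q powr \<bar>real j - real j0\<bar>)"
      unfolding a_def q_def by (intro sum_mono card_deviates_tolerance_le[OF f \<open>r \<ge> 1\<close>])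
    also have "\<dots> = 7 * 2 ^ j0 * (\<Sum>k<N. a ^ k) * (\<Sum>j<n. q powr \<bar>real j - real j0\<bar>)"
      by (simp add: sum_distrib_left[symmetric] sum_distrib_right[symmetric] mult.assoc)
    also have "\<dots> \<le> 7 * 2 ^ j0 * (1 / (1 - a)) * (2 / (1 - q))"
      using a q by (intro mult_mono mult_left_mono sum_geometric_le sum_geometric_two_sided_le)
        (auto intro!: sum_nonneg mult_nonneg_nonneg)
    finally show "real (total_excess f (tolerance r j0) N n 0 0)
        \<le> 7 * (1 / (1 - a)) * (2 / (1 - q)) * 2 ^ j0" by (simp add: mult_ac)
  qed
qed

section \<open>Brackets for truncated concave functions\<close>

definition bracket_cover ::
    "real set \<Rightarrow> real \<Rightarrow> real \<Rightarrow> (real \<Rightarrow> real) set \<Rightarrow> ((real \<Rightarrow> real) \<times> (real \<Rightarrow> real)) set \<Rightarrow> bool" where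
  "bracket_cover A r e F B \<longleftrightarrow> finite B \<and>
     (\<forall>(l, u) \<in> B. l \<in> borel_measurable borel \<and> u \<in> borel_measurable borel \<and>
        (\<integral>\<^sup>+x. ennreal (\<bar>u x - l x\<bar> powr r) * indicator A x \<partial>lborel) \<le> ennreal e) \<and>
     (\<forall>f \<in> F. \<exists>(l, u) \<in> B. \<forall>x \<in> A. l x \<le> f x \<and> f x \<le> u x)"

text \<open>Vanishing at both ends lets the encoding start from exact end values. Slices have this
  property after rescaling an interval outside which they vanish.\<close>

definition pinned_trunc_concave :: "(real \<Rightarrow> real) set" where
  "pinned_trunc_concave = {f \<in> trunc_concave. f 0 = 0 \<and> f 1 = 0}"

lemma bracket_cover_mono: "bracket_cover A r e F B \<Longrightarrow> e \<le> e' \<Longrightarrow> bracket_cover A r e' F B"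
  unfolding bracket_cover_def by (fastforce intro: order_trans[OF _ ennreal_leI])

lemma tolerance_pos: "tolerance r j0 j > 0"
  by (simp add: tolerance_def)

lemma tolerance_Suc_mono: "r \<ge> 1 \<Longrightarrow> tolerance r j0 j \<le> tolerance r j0 (Suc j)"
  unfolding tolerance_def by (intro powr_mono diff_mono divide_right_mono) auto

lemma tolerance_powr:
  assumes "r \<ge> 1"
  shows "tolerance r j0 j powr r = 2 powr (- real j0 - 2 * real j0 * r) * 2 ^ j"
proof -
  have "((real j - real j0) / r - 2 * real j0) * r = (- real j0 - 2 * real j0 * r) + real j"
    using assms by (simp add: field_simps)
  then show ?thesis by (simp add: tolerance_def powr_powr powr_add powr_realpow)
qed

lemma trunc_concave_dyadic_brackets:
  assumes "r \<ge> 1"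
  obtains K C where "K > 0" "C \<ge> 1"
    "\<And>j0. \<exists>B. real (card B) \<le> exp (K * 2 ^ j0) \<and>
      bracket_cover {0..<1} r (C * (1 / 4 ^ j0) powr r) pinned_trunc_concave B"
proof -
  obtain K where K: "K > 0" "\<And>f N n j0. f \<in> trunc_concave \<Longrightarrow> real (total_excess f (tolerance r j0) N n 0 0) \<le> K * 2 ^ j0"
    using total_excess_tolerance_le[OF assms] by blast
  show thesis
  proof (rule that)
    show "ln 4 + K * ln 800 > 0" using K by (intro add_pos_pos mult_pos_pos) auto
    have "1 \<le> (4::real) powr r" using assms by (intro ge_one_powr_ge_zero) auto
    then have "1 * 1 \<le> (1 + K) * 4 powr r" using K by (intro mult_mono) auto
    then show "(1 + K) * 4 powr r \<ge> 1" by simp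
    fix j0
    define \<delta> where "\<delta> = tolerance r j0"
    \<comment> \<open>A level at which the tolerance has reached 1: (n - j0) / r \<ge> 2 j0.\<close>
    define n where "n = j0 + nat \<lceil>2 * real j0 * r\<rceil>"
    \<comment> \<open>The tolerance is smallest at level 0, where it is at least 2^(-3 j0) because r
      \<ge> 1; the added 1 ensures N \<ge> 1.\<close>
    define N where "N = 3 * j0 + 1"
    define F where "F = {f \<in> trunc_concave. f 0 = 0 \<and> f 1 = 0}"
    define T where "T = (\<lambda>f. encode f \<delta> n 0 0 0 0) ` F"
    define br where "br = (\<lambda>t. (\<lambda>x. centre \<delta> 0 0 0 0 t x - radius \<delta> 0 0 t x, \<lambda>x. centre \<delta> 0 0 0 0 t x + radius \<delta> 0 0 t x))"
    have pos: "\<delta> j > 0" for j by (simp add: \<delta>_def tolerance_pos)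
    have mono: "\<delta> j \<le> \<delta> (Suc j)" for j using assms by (simp add: \<delta>_def tolerance_Suc_mono)
    have n: "\<delta> (0 + n) \<ge> 1"
    proof -
      have "2 * real j0 * r \<le> real n - real j0" by (simp add: n_def) linarith
      then have "2 * real j0 \<le> (real n - real j0) / r" using assms by (simp add: field_simps)
      then show ?thesis by (simp add: \<delta>_def tolerance_def ge_one_powr_ge_zero)
    qed
    have N: "\<delta> j * 2 ^ N \<ge> 1" "N \<ge> 1" for j
    proof -
      have "\<delta> j * 2 ^ N = 2 powr ((real j - real j0) / r - 2 * real j0 + real N)"
        by (simp add: \<delta>_def tolerance_def powr_add powr_realpow)
      moreover have "real j0 / r \<le> real j0" "0 \<le> real j / r" using divide_left_mono[of 1 r "real j0"] assms by auto
      then have "0 \<le> (real j - real j0) / r - 2 * real j0 + real N"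
        by (simp add: N_def diff_divide_distrib)
      ultimately show "\<delta> j * 2 ^ N \<ge> 1" by (simp add: ge_one_powr_ge_zero)
    qed (simp add: N_def)
    have enc: "encode f \<delta> n 0 0 0 0 \<in> codes (5 * 2 ^ N) n \<and>
        weight (encode f \<delta> n 0 0 0 0) \<ge> 1 / 4 * (1 / 800) ^ total_excess f \<delta> N n 0 0 \<and>
        leaves (encode f \<delta> n 0 0 0 0) \<le> 1 + total_excess f \<delta> N n 0 0" if "f \<in> F" for f
      by (rule encode_bounds) (use that pos mono N in \<open>auto simp: F_def dyadic_def less_imp_le\<close>)
    \<comment> \<open>A lower bound for all code weights: the total excess is at most K 2^j0, and
      the factor 1/4 is absorbed through 1 \<le> 2^j0.\<close>
    define w where "w = exp (- ((ln 4 + K * ln 800) * 2 ^ j0))"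
    have weight: "weight (encode f \<delta> n 0 0 0 0) \<ge> w" if "f \<in> F" for f
    proof -
      let ?S = "real (total_excess f \<delta> N n 0 0)"
      have "?S \<le> K * 2 ^ j0" using K(2) that by (auto simp: \<delta>_def F_def)
      then have "ln 800 * ?S \<le> ln 800 * (K * 2 ^ j0)" by (intro mult_left_mono) auto
      moreover have "ln 4 * 1 \<le> ln (4::real) * 2 ^ j0" by (intro mult_left_mono) auto
      moreover have "(ln 4 + K * ln 800) * 2 ^ j0 = ln 4 * 2 ^ j0 + ln 800 * (K * 2 ^ j0)"
        by (simp add: algebra_simps)
      ultimately have "w \<le> exp (- ln 4 - ln 800 * ?S)" unfolding w_def exp_le_cancel_iff by linarith
      also have "\<dots> = 1 / 4 * (1 / 800) ^ total_excess f \<delta> N n 0 0"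
      proof -
        have "- ln 4 - ln 800 * ?S = - ln (4::real) + ?S * (- ln 800)" by simp
        moreover have "exp (- ln 4) = 1 / (4::real)" "exp (- ln 800) = 1 / (800::real)"
          by (simp_all add: exp_minus inverse_eq_divide)
        ultimately show ?thesis by (simp only: exp_add exp_of_nat_mult)
      qed
      finally show ?thesis using enc[OF that] by linarith
    qed
    have T: "T \<subseteq> codes (5 * 2 ^ N) n" using enc by (auto simp: T_def)
    then have fin: "finite T" using finite_codes finite_subset by blast
    have "real (card T) \<le> 1 / w" by (rule card_codes_le[OF T]) (use weight in \<open>auto simp: T_def w_def\<close>)
    moreover have "card (br ` T) \<le> card T" by (rule card_image_le[OF fin])
    ultimately have card: "real (card (br ` T)) \<le> exp ((ln 4 + K * ln 800) * 2 ^ j0)"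
      by (simp add: w_def exp_minus divide_inverse)
    have int: "(\<integral>\<^sup>+x. ennreal (\<bar>2 * radius \<delta> 0 0 t x\<bar> powr r) * indicator {0..<1} x \<partial>lborel)
          \<le> ennreal ((1 + K) * 4 powr r * (1 / 4 ^ j0) powr r)" if t: "t \<in> T" for t
    proof -
      define \<kappa> where "\<kappa> = 2 powr (- real j0 - 2 * real j0 * r)"
      obtain f where f: "f \<in> F" "t = encode f \<delta> n 0 0 0 0" using t unfolding T_def by blast
      have "real (leaves t) \<le> 1 + real (total_excess f \<delta> N n 0 0)" using enc[OF f(1)] f(2) by simp
      also have "\<dots> \<le> 1 + K * 2 ^ j0" using K(2) f by (auto simp: \<delta>_def F_def)
      also have "\<dots> \<le> (1 + K) * 2 ^ j0" by (simp add: algebra_simps)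
      finally have lv: "real (leaves t) \<le> (1 + K) * 2 ^ j0" .
      have radius_pos: "radius \<delta> j i t x \<ge> 0" for j i x
        by (induction t arbitrary: j i) (auto simp: pos less_imp_le)
      have "(\<integral>\<^sup>+x. ennreal (\<bar>2 * radius \<delta> 0 0 t x\<bar> powr r) * indicator {0..<1} x \<partial>lborel)
          = (\<integral>\<^sup>+x. ennreal ((2 * radius \<delta> 0 0 t x) powr r) * indicator {dyadic 0 0..<dyadic 0 (Suc 0)} x \<partial>lborel)"
        by (simp add: radius_pos dyadic_def)
      also have "\<dots> = ennreal (real (leaves t) * (4 powr r * \<kappa>))"
        using assms by (intro nn_integral_radius) (auto simp: \<delta>_def tolerance_pos tolerance_powr \<kappa>_def)
      also have "\<dots> \<le> ennreal ((1 + K) * 2 ^ j0 * (4 powr r * \<kappa>))"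
        by (intro ennreal_leI mult_right_mono lv) (simp add: \<kappa>_def)
      also have "2 ^ j0 * \<kappa> = (1 / 4 ^ j0) powr r"
      proof -
        have "1 / 4 ^ j0 = 2 powr (- 2 * real j0)"
          by (simp add: powr_minus_divide powr_powr[symmetric] powr_realpow)
        then have "(1 / 4 ^ j0) powr r = 2 powr (- 2 * real j0 * r)" by (simp add: powr_powr)
        moreover have "2 ^ j0 * \<kappa> = 2 powr (real j0 + (- real j0 - 2 * real j0 * r))"
          unfolding powr_add \<kappa>_def by (simp add: powr_realpow)
        ultimately show ?thesis by simp
      qed
      then have "(1 + K) * 4 powr r * (2 ^ j0 * \<kappa>) = (1 + K) * 4 powr r * (1 / 4 ^ j0) powr r"
        by (rule arg_cong)
      then have "(1 + K) * 2 ^ j0 * (4 powr r * \<kappa>) = (1 + K) * 4 powr r * (1 / 4 ^ j0) powr r"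
        by (simp only: mult_ac)
      finally show ?thesis .
    qed
    have "bracket_cover {0..<1} r ((1 + K) * 4 powr r * (1 / 4 ^ j0) powr r) pinned_trunc_concave (br ` T)"
      unfolding bracket_cover_def
    proof (intro conjI ballI)
      show "finite (br ` T)" using fin by simp
      show "case p of (l, u) \<Rightarrow> l \<in> borel_measurable borel \<and> u \<in> borel_measurable borel \<and>
        (\<integral>\<^sup>+x. ennreal (\<bar>u x - l x\<bar> powr r) * indicator {0..<1} x \<partial>lborel)
          \<le> ennreal ((1 + K) * 4 powr r * (1 / 4 ^ j0) powr r)" if "p \<in> br ` T" for p
        using that int by (auto simp: br_def)
      show "\<exists>(l, u) \<in> br ` T. \<forall>x \<in> {0..<1}. l x \<le> f x \<and> f x \<le> u x"
        if f: "f \<in> pinned_trunc_concave" for f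
      proof -
        let ?t = "encode f \<delta> n 0 0 0 0"
        have "?t \<in> T" using f by (auto simp: T_def F_def pinned_trunc_concave_def)
        moreover have "\<bar>f x - centre \<delta> 0 0 0 0 ?t x\<bar> \<le> radius \<delta> 0 0 ?t x" if "x \<in> {0..<1}" for x
          by (rule abs_diff_centre_le)
            (use f pos mono n that in \<open>auto simp: dyadic_def less_imp_le pinned_trunc_concave_def\<close>)
        ultimately show ?thesis by (force simp: br_def abs_le_iff)
      qed
    qed
    then show "\<exists>B. real (card B) \<le> exp ((ln 4 + K * ln 800) * 2 ^ j0) \<and>
      bracket_cover {0..<1} r ((1 + K) * 4 powr r * (1 / 4 ^ j0) powr r) pinned_trunc_concave B"
      using card by blast
  qed
qed

text \<open>The scale j0 is the least with D 4^-j0 \<le> \<epsilon>; failure of its predecessor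
  gives 2^j0 \<le> 2 sqrt (D / \<epsilon>). The predecessor exists for \<epsilon> < 1 since D \<ge>
  1. For \<epsilon> \<ge> 1 the constants 0 and 1 form a single bracket.\<close>

lemma trunc_concave_brackets:
  assumes "r \<ge> 1"
  obtains K where "K > 0"
    "\<And>\<epsilon>. \<epsilon> > 0 \<Longrightarrow> \<exists>B. real (card B) \<le> exp (K * \<epsilon> powr (- (1 / 2))) \<and>
      bracket_cover {0..<1} r (\<epsilon> powr r) pinned_trunc_concave B"
proof -
  obtain K C where K: "K > 0" "C \<ge> 1"
    and main: "\<And>j0. \<exists>B. real (card B) \<le> exp (K * 2 ^ j0) \<and>
      bracket_cover {0..<1} r (C * (1 / 4 ^ j0) powr r) pinned_trunc_concave B"
    using trunc_concave_dyadic_brackets[OF assms] by metis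
  define D where "D = C powr (1 / r)"
  have D: "D \<ge> 1" using K assms by (simp add: D_def ge_one_powr_ge_zero)
  have DC: "D powr r = C" using K assms by (simp add: D_def powr_powr)
  show thesis
  proof (rule that)
    show "2 * K * sqrt D > 0" using K D by simp
    fix \<epsilon> :: real assume "\<epsilon> > 0"
    show "\<exists>B. real (card B) \<le> exp (2 * K * sqrt D * \<epsilon> powr (- (1 / 2))) \<and>
      bracket_cover {0..<1} r (\<epsilon> powr r) pinned_trunc_concave B"
    proof (cases "\<epsilon> \<ge> 1")
      case True
      have "1 \<le> \<epsilon> powr r" using True assms by (simp add: ge_one_powr_ge_zero)
      moreover have "(\<integral>\<^sup>+x. indicator {0..<1::real} x \<partial>lborel) = 1" by simp
      ultimately show ?thesis using K D
        by (intro exI[of _ "{(\<lambda>_. 0, \<lambda>_. 1)}"])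
          (auto simp: bracket_cover_def pinned_trunc_concave_def trunc_concave_bounds)
    next
      case False
      define j0 where "j0 = (LEAST j. D * (1 / 4) ^ j \<le> \<epsilon>)"
      obtain j where "(1 / 4 :: real) ^ j < \<epsilon> / D"
        using real_arch_pow_inv[of "\<epsilon> / D" "1 / 4"] \<open>\<epsilon> > 0\<close> D by auto
      then have "D * (1 / 4) ^ j \<le> \<epsilon>" using D by (simp add: field_simps)
      then have le: "D * (1 / 4) ^ j0 \<le> \<epsilon>" unfolding j0_def by (rule LeastI)
      have "j0 \<noteq> 0"
      proof
        assume "j0 = 0"
        then show False using le D False by simp
      qed
      then obtain j' where j': "j0 = Suc j'" using not0_implies_Suc by blast
      have "\<not> D * (1 / 4) ^ j' \<le> \<epsilon>"
        using not_less_Least[of j' "\<lambda>j. D * (1 / 4) ^ j \<le> \<epsilon>"] j' unfolding j0_def by simp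
      then have "4 ^ j0 \<le> 4 * D / \<epsilon>" using \<open>\<epsilon> > 0\<close> by (simp add: j' field_simps)
      then have "(2 ^ j0)\<^sup>2 \<le> 4 * D / \<epsilon>" by (simp add: power2_eq_square power_mult_distrib[symmetric])
      then have "2 ^ j0 \<le> sqrt (4 * D / \<epsilon>)" by (rule real_le_rsqrt)
      also have "\<dots> = 2 * sqrt D * \<epsilon> powr (- (1 / 2))"
        using \<open>\<epsilon> > 0\<close> by (simp add: real_sqrt_mult real_sqrt_divide powr_minus_divide powr_half_sqrt)
      finally have "K * 2 ^ j0 \<le> K * (2 * sqrt D * \<epsilon> powr (- (1 / 2)))"
        using K by (intro mult_left_mono) auto
      then have card: "exp (K * 2 ^ j0) \<le> exp (2 * K * sqrt D * \<epsilon> powr (- (1 / 2)))"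
        by (simp add: algebra_simps)
      have "C * (1 / 4 ^ j0) powr r = (D * (1 / 4) ^ j0) powr r"
        by (subst powr_mult) (use D in \<open>auto simp: DC power_divide\<close>)
      also have "\<dots> \<le> \<epsilon> powr r" using D le assms by (intro powr_mono2) auto
      finally have int: "C * (1 / 4 ^ j0) powr r \<le> \<epsilon> powr r" .
      obtain B where "real (card B) \<le> exp (K * 2 ^ j0)"
        "bracket_cover {0..<1} r (C * (1 / 4 ^ j0) powr r) pinned_trunc_concave B"
        using main[of j0] by blast
      then show ?thesis using card bracket_cover_mono[OF _ int] order_trans by blast
    qed
  qed
qed

section \<open>Assembling brackets of slices\<close>

lemma trunc_concave_affine:
  assumes "f \<in> trunc_concave"
  shows "(\<lambda>x. f (a + b * x)) \<in> trunc_concave"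
proof -
  have "(1 - s) * f (a + b * x) + s * f (a + b * y) \<le> f (a + b * ((1 - s) * x + s * y))"
    if "0 < f (a + b * x)" "0 < f (a + b * y)" "0 \<le> s" "s \<le> 1" for x y s
  proof -
    have "a + b * ((1 - s) * x + s * y) = (1 - s) * (a + b * x) + s * (a + b * y)"
      by (simp add: algebra_simps)
    then show ?thesis using trunc_concaveD[OF assms that] by simp
  qed
  then show ?thesis using trunc_concave_bounds[OF assms] by (simp add: trunc_concave_def)
qed

text \<open>A substitute for the triangle inequality in the r-norm: with weights of total at most 1
  the sum is at most the largest \<open>a l / w l\<close>, and the r-th power of a maximum is at
  most the sum of the r-th powers.\<close>

lemma powr_sum_le_weighted:
  fixes a w :: "nat \<Rightarrow> real"
  assumes "r \<ge> 1" "\<And>l. 0 \<le> a l" "\<And>l. 0 < w l" "(\<Sum>l<n. w l) \<le> 1"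
  shows "(\<Sum>l<n. a l) powr r \<le> (\<Sum>l<n. (a l / w l) powr r)"
proof (cases "n = 0")
  case False
  define m where "m = Max ((\<lambda>l. a l / w l) ` {..<n})"
  have "m \<in> (\<lambda>l. a l / w l) ` {..<n}" unfolding m_def using False by (intro Max_in) auto
  then obtain k where k: "k < n" "m = a k / w k" by auto
  have m: "a l / w l \<le> m" if "l < n" for l using that by (simp add: m_def)
  have "0 \<le> m" using assms(2)[of k] assms(3)[of k] by (simp add: k)
  have "(\<Sum>l<n. a l) \<le> (\<Sum>l<n. w l * m)"
    using m assms(3) by (intro sum_mono) (simp add: field_simps)
  also have "\<dots> = (\<Sum>l<n. w l) * m" by (simp add: sum_distrib_right)
  also have "\<dots> \<le> m" using assms(4) \<open>0 \<le> m\<close> mult_right_mono[of _ 1 m] by simp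
  finally have "(\<Sum>l<n. a l) powr r \<le> (a k / w k) powr r"
    using assms(1,2) k by (intro powr_mono2) (auto intro: sum_nonneg)
  also have "\<dots> \<le> (\<Sum>l<n. (a l / w l) powr r)"
    using k by (intro member_le_sum) auto
  finally show ?thesis .
qed simp

lemma powr_add_le:
  fixes s t :: real
  assumes "r \<ge> 1" "0 \<le> s" "0 \<le> t"
  shows "(s + t) powr r \<le> 2 powr r * (s powr r + t powr r)"
proof -
  have "(s + t) powr r \<le> (2 * max s t) powr r" using assms by (intro powr_mono2) auto
  also have "\<dots> = 2 powr r * max s t powr r" using assms by (simp add: powr_mult)
  also have "max s t powr r \<le> s powr r + t powr r" by (simp add: max_def)
  finally show ?thesis by simp
qed

definition stretch :: "real \<Rightarrow> (real \<Rightarrow> real) \<Rightarrow> real \<Rightarrow> real" where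
  "stretch R p x = (if - R \<le> x \<and> x < R then p ((x + R) / (2 * R)) else 0)"

lemma borel_measurable_stretch [measurable]:
  assumes [measurable]: "p \<in> borel_measurable borel"
  shows "stretch R p \<in> borel_measurable borel"
  unfolding stretch_def[abs_def] by measurable

lemma nn_integral_stretch:
  assumes "R > 0" "r > 0" and [measurable]: "p \<in> borel_measurable borel" "q \<in> borel_measurable borel"
  shows "(\<integral>\<^sup>+x. ennreal (\<bar>stretch R q x - stretch R p x\<bar> powr r) \<partial>lborel)
       = ennreal (2 * R) * (\<integral>\<^sup>+x. ennreal (\<bar>q x - p x\<bar> powr r) * indicator {0..<1} x \<partial>lborel)"
proof -
  have "(\<integral>\<^sup>+x. ennreal (\<bar>stretch R q x - stretch R p x\<bar> powr r) \<partial>lborel)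
      = ennreal \<bar>2 * R\<bar> * (\<integral>\<^sup>+x. ennreal (\<bar>stretch R q (- R + 2 * R * x) - stretch R p (- R + 2 * R * x)\<bar> powr r) \<partial>lborel)"
    using assms by (intro nn_integral_real_affine) auto
  also have "(\<integral>\<^sup>+x. ennreal (\<bar>stretch R q (- R + 2 * R * x) - stretch R p (- R + 2 * R * x)\<bar> powr r) \<partial>lborel)
      = (\<integral>\<^sup>+x. ennreal (\<bar>q x - p x\<bar> powr r) * indicator {0..<1} x \<partial>lborel)"
    using assms by (intro nn_integral_cong) (auto simp: stretch_def zero_le_mult_iff split: split_indicator)
  finally show ?thesis using assms by simp
qed

lemma stretch_between:
  assumes "R > 0" "\<And>x. R \<le> \<bar>x\<bar> \<Longrightarrow> f x = 0"
    and "\<And>x. x \<in> {0..<1} \<Longrightarrow> p x \<le> f (- R + 2 * R * x) \<and> f (- R + 2 * R * x) \<le> q x"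
  shows "stretch R p x \<le> f x \<and> f x \<le> stretch R q x"
proof (cases "- R \<le> x \<and> x < R")
  case True
  define t where "t = (x + R) / (2 * R)"
  have "x = - R + 2 * R * t" "t \<in> {0..<1}" using True assms(1) by (auto simp: t_def field_simps)
  then show ?thesis using assms(3)[of t] True by (simp add: stretch_def t_def[symmetric])
next
  case False
  then show ?thesis using assms(2)[of x] by (auto simp: stretch_def)
qed

text \<open>The class \<open>H\<close> is decomposed into dyadic slices \<open>\<gamma> l \<circ> f l\<close>; the slices spread out at rate
  \<open>2 ^ l\<close> and shrink at rate \<open>2 powr (-\<alpha> l)\<close>, so \<open>\<alpha> > 1 / r\<close> leaves room for tolerances
  growing geometrically with \<open>l\<close>.\<close>

lemma sliced_class_brackets:
  fixes \<gamma> :: "nat \<Rightarrow> real \<Rightarrow> real" and E :: "nat \<Rightarrow> real \<Rightarrow> real" and H :: "(real \<Rightarrow> real) set"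
  assumes r: "r \<ge> 1" and \<alpha>: "\<alpha> > 1 / r" and L: "L > 0" and \<rho>: "\<rho> > 0"
    and mono: "\<And>l. mono (\<gamma> l)"
    and lip: "\<And>l s t. s \<le> t \<Longrightarrow> \<gamma> l t - \<gamma> l s \<le> L * (2 powr - \<alpha>) ^ l * (t - s)"
    and E [measurable]: "\<And>n. E n \<in> borel_measurable borel" and E_nonneg: "\<And>n x. 0 \<le> E n x"
    and E_small: "\<And>\<eta>. \<eta> > 0 \<Longrightarrow> \<exists>n. (\<integral>\<^sup>+x. ennreal (E n x powr r) \<partial>lborel) \<le> ennreal \<eta>"
    and H: "\<And>P. P \<in> H \<Longrightarrow> \<exists>f. (\<forall>l. f l \<in> trunc_concave \<and> (\<forall>x. \<rho> * 2 ^ l \<le> \<bar>x\<bar> \<longrightarrow> f l x = 0)) \<and>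
       (\<forall>n x. (\<Sum>l<n. \<gamma> l (f l x)) \<le> P x \<and> P x \<le> (\<Sum>l<n. \<gamma> l (f l x)) + E n x)"
  obtains K where "\<And>\<epsilon>. \<epsilon> > 0 \<Longrightarrow> \<exists>B. real (card B) \<le> exp (K * \<epsilon> powr (- (1 / 2))) \<and>
    bracket_cover UNIV r (\<epsilon> powr r) H B"
proof -
  obtain K where K: "K > 0"
    and core: "\<And>\<epsilon>. \<epsilon> > 0 \<Longrightarrow> \<exists>B. real (card B) \<le> exp (K * \<epsilon> powr (- (1 / 2))) \<and>
      bracket_cover {0..<1} r (\<epsilon> powr r) pinned_trunc_concave B"
    using trunc_concave_brackets[OF r] by metis
  \<comment> \<open>Four equal shares of the surplus in \<alpha>: two let the tolerances
    \<open>e l\<close> grow, so that the entropies decay like 2^(-\<beta> l); one pays for dividing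
    by \<open>w l\<close>; the last leaves errors that decay at least as fast as
    \<open>w l\<close>.\<close>
  define \<beta> where "\<beta> = (\<alpha> - 1 / r) / 4"
  define b where "b = 2 powr - \<beta>"
  have \<beta>: "\<beta> > 0" using \<alpha> by (simp add: \<beta>_def)
  have "2 powr - \<beta> < 2 powr 0" using \<beta> by (intro powr_less_mono) auto
  then have b: "0 < b" "b < 1" by (auto simp: b_def)
  define w where "w l = (1 - b) * b ^ l" for l
  have w: "0 < w l" "(\<Sum>l<n. w l) \<le> 1" for l n
  proof -
    have "(\<Sum>l<n. w l) = (1 - b) * (\<Sum>l<n. b ^ l)" by (simp add: w_def sum_distrib_left)
    also have "\<dots> \<le> (1 - b) * (1 / (1 - b))" using b by (intro mult_left_mono sum_geometric_le) auto
    finally show "(\<Sum>l<n. w l) \<le> 1" using b by simp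
  qed (use b in \<open>simp add: w_def\<close>)
  \<comment> \<open>Makes the estimate \<open>slice\<close> an equality at l = 0. The quarter of
    \<epsilon> there compensates two factors \<open>2 powr r\<close>, one from
    \<open>powr_add_le\<close> and one bounding \<open>(\<Sum>l<n. w l) + 1\<close>.\<close>
  define c where "c = (1 - b) / (4 * L) * ((1 - b) / (2 * \<rho>)) powr (1 / r)"
  have c: "c > 0" using b L \<rho> by (simp add: c_def)
  show thesis
  proof (rule that)
    fix \<epsilon> :: real assume \<epsilon>: "\<epsilon> > 0"
    define e where "e l = c * \<epsilon> * 2 powr (2 * \<beta> * real l)" for l
    have e: "e l > 0" for l using c \<epsilon> by (simp add: e_def)
    have e_sum: "(\<Sum>l<n. K * e l powr (- (1 / 2))) \<le> K * c powr (- (1 / 2)) / (1 - b) * \<epsilon> powr (- (1 / 2))" for n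
    proof -
      have "e l powr (- (1 / 2)) = c powr (- (1 / 2)) * \<epsilon> powr (- (1 / 2)) * b ^ l" for l
        using c \<epsilon> by (simp add: e_def b_def powr_mult powr_powr powr_realpow[symmetric])
      then have "(\<Sum>l<n. K * e l powr (- (1 / 2))) = K * c powr (- (1 / 2)) * \<epsilon> powr (- (1 / 2)) * (\<Sum>l<n. b ^ l)"
        by (simp only: sum_distrib_left mult.assoc)
      also have "\<dots> \<le> K * c powr (- (1 / 2)) * \<epsilon> powr (- (1 / 2)) * (1 / (1 - b))"
        using b K by (intro mult_left_mono sum_geometric_le) auto
      finally show ?thesis by simp
    qed
    have slice: "(L * (2 powr - \<alpha>) ^ l / w l) powr r * (2 * (\<rho> * 2 ^ l) * e l powr r) \<le> w l * (\<epsilon> / 4) powr r" for l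
    proof -
      let ?l = "real l"
      have "L * (2 powr - \<alpha>) ^ l / w l * e l
          = \<epsilon> / 4 * ((1 - b) / (2 * \<rho>)) powr (1 / r) * 2 powr (3 * \<beta> * ?l - \<alpha> * ?l)"
      proof -
        have "2 powr (3 * \<beta> * ?l - \<alpha> * ?l) * b ^ l = (2 powr - \<alpha>) ^ l * 2 powr (2 * \<beta> * ?l)"
          unfolding b_def by (simp add: powr_realpow[symmetric] powr_powr powr_add[symmetric] algebra_simps)
        moreover have "L * q / ((1 - b) * p) * ((1 - b) / (4 * L) * D * \<epsilon> * z) = \<epsilon> / 4 * D * y"
          if "y * p = q * z" "p > 0" for q p D z y
        proof -
          have "L * q / ((1 - b) * p) * ((1 - b) / (4 * L) * D * \<epsilon> * z) = (q * z) * (\<epsilon> * D) / (4 * p)"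
            using L b that(2) by (simp add: divide_simps)
          then show ?thesis unfolding that(1)[symmetric] using that(2) by simp
        qed
        ultimately show ?thesis unfolding e_def c_def w_def using b by simp
      qed
      then have "(L * (2 powr - \<alpha>) ^ l / w l * e l) powr r
          = (\<epsilon> / 4 * ((1 - b) / (2 * \<rho>)) powr (1 / r) * 2 powr (3 * \<beta> * ?l - \<alpha> * ?l)) powr r"
        by (rule arg_cong)
      also have "\<dots> = (\<epsilon> / 4) powr r * ((1 - b) / (2 * \<rho>)) * 2 powr ((3 * \<beta> * ?l - \<alpha> * ?l) * r)"
      proof -
        have "(((1 - b) / (2 * \<rho>)) powr (1 / r)) powr r = (1 - b) / (2 * \<rho>)"
          using b \<rho> r by (simp add: powr_powr)
        then show ?thesis by (simp only: powr_mult powr_powr[of 2])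
      qed
      finally have 1: "(L * (2 powr - \<alpha>) ^ l / w l * e l) powr r
          = (\<epsilon> / 4) powr r * ((1 - b) / (2 * \<rho>)) * 2 powr ((3 * \<beta> * ?l - \<alpha> * ?l) * r)" .
      have 2: "(3 * \<beta> * ?l - \<alpha> * ?l) * r = - \<beta> * r * ?l - ?l"
        using r by (simp add: \<beta>_def field_simps)
      have 3: "2 powr (- \<beta> * r * ?l - ?l) * 2 ^ l = 2 powr (- \<beta> * r * ?l)"
        by (simp add: powr_realpow[symmetric] powr_add[symmetric])
      have "(L * (2 powr - \<alpha>) ^ l / w l * e l) powr r * (2 * (\<rho> * 2 ^ l))
          = (\<epsilon> / 4) powr r * (1 - b) * (2 powr (- \<beta> * r * ?l - ?l) * 2 ^ l)"
        unfolding 1 2 using \<rho> by simp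
      also have "\<dots> = (\<epsilon> / 4) powr r * (1 - b) * 2 powr (- \<beta> * r * ?l)"
        by (simp only: 3)
      also have "\<dots> \<le> (\<epsilon> / 4) powr r * (1 - b) * 2 powr (- \<beta> * ?l)"
        using b \<beta> r by (intro mult_left_mono powr_mono) (auto simp: mult_le_cancel_left1 mult_right_mono)
      also have "2 powr (- \<beta> * ?l) = b ^ l"
        by (simp add: b_def powr_realpow[symmetric] powr_powr)
      finally show ?thesis
        unfolding w_def powr_mult by (simp only: mult_ac)
    qed
    have "\<forall>l. \<exists>B. real (card B) \<le> exp (K * e l powr (- (1 / 2))) \<and>
      bracket_cover {0..<1} r (e l powr r) pinned_trunc_concave B" using core e by blast
    then obtain Bs where Bs: "\<And>l. real (card (Bs l)) \<le> exp (K * e l powr (- (1 / 2)))"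
      "\<And>l. bracket_cover {0..<1} r (e l powr r) pinned_trunc_concave (Bs l)" by metis
    \<comment> \<open>The number of slices may depend on \<epsilon> in any way, because
      \<open>e_sum\<close> bounds the total entropy uniformly in n.\<close>
    obtain n where n: "(\<integral>\<^sup>+x. ennreal (E n x powr r) \<partial>lborel) \<le> ennreal ((\<epsilon> / 4) powr r)"
      using E_small[of "(\<epsilon> / 4) powr r"] \<epsilon> by auto
    define R where "R l = \<rho> * 2 ^ l" for l :: nat
    have R: "R l > 0" for l using \<rho> by (simp add: R_def)
    define lo where "lo \<sigma> x = (\<Sum>l<n. \<gamma> l (stretch (R l) (fst (\<sigma> l)) x))" for \<sigma> :: "nat \<Rightarrow> (real \<Rightarrow> real) \<times> (real \<Rightarrow> real)" and x
    define up where "up \<sigma> x = (\<Sum>l<n. \<gamma> l (stretch (R l) (snd (\<sigma> l)) x)) + E n x" for \<sigma> :: "nat \<Rightarrow> (real \<Rightarrow> real) \<times> (real \<Rightarrow> real)" and x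
    define S where "S = (\<Pi>\<^sub>E l\<in>{..<n}. Bs l)"
    have finB: "finite (Bs l)" for l using Bs(2)[of l] by (simp add: bracket_cover_def)
    then have finS: "finite S" unfolding S_def by (intro finite_PiE) auto
    have [measurable]: "\<gamma> l \<in> borel_measurable borel" for l by (rule borel_measurable_mono[OF mono])
    have meas: "fst (\<sigma> l) \<in> borel_measurable borel" "snd (\<sigma> l) \<in> borel_measurable borel"
      and int: "(\<integral>\<^sup>+x. ennreal (\<bar>snd (\<sigma> l) x - fst (\<sigma> l) x\<bar> powr r) * indicator {0..<1} x \<partial>lborel) \<le> ennreal (e l powr r)"
      if "\<sigma> \<in> S" "l < n" for \<sigma> l
    proof -
      have "\<sigma> l \<in> Bs l" using that by (auto simp: S_def)
      then show "fst (\<sigma> l) \<in> borel_measurable borel" "snd (\<sigma> l) \<in> borel_measurable borel"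
        "(\<integral>\<^sup>+x. ennreal (\<bar>snd (\<sigma> l) x - fst (\<sigma> l) x\<bar> powr r) * indicator {0..<1} x \<partial>lborel) \<le> ennreal (e l powr r)"
        using Bs(2)[of l] by (auto simp: bracket_cover_def case_prod_beta)
    qed
    have lip': "\<bar>\<gamma> l t - \<gamma> l s\<bar> \<le> L * (2 powr - \<alpha>) ^ l * \<bar>t - s\<bar>" for l s t
      using lip[of s t l] lip[of t s l] monoD[OF mono, of s t l] monoD[OF mono, of t s l]
      by (cases "s \<le> t") auto
    have err: "(\<integral>\<^sup>+x. ennreal (\<bar>up \<sigma> x - lo \<sigma> x\<bar> powr r) \<partial>lborel) \<le> ennreal (\<epsilon> powr r)" if \<sigma>: "\<sigma> \<in> S" for \<sigma>
    proof -
      define a where "a l x = L * (2 powr - \<alpha>) ^ l * \<bar>stretch (R l) (snd (\<sigma> l)) x - stretch (R l) (fst (\<sigma> l)) x\<bar>" for l x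
      have a: "0 \<le> a l x" for l x using L by (simp add: a_def)
      have pw: "\<bar>up \<sigma> x - lo \<sigma> x\<bar> powr r \<le> 2 powr r * ((\<Sum>l<n. (a l x / w l) powr r) + E n x powr r)" for x
      proof -
        have "up \<sigma> x - lo \<sigma> x = (\<Sum>l<n. \<gamma> l (stretch (R l) (snd (\<sigma> l)) x) - \<gamma> l (stretch (R l) (fst (\<sigma> l)) x)) + E n x"
          by (simp add: up_def lo_def sum_subtractf)
        also have "\<bar>\<dots>\<bar> \<le> (\<Sum>l<n. a l x) + E n x"
        proof -
          have "\<bar>\<Sum>l<n. \<gamma> l (stretch (R l) (snd (\<sigma> l)) x) - \<gamma> l (stretch (R l) (fst (\<sigma> l)) x)\<bar> \<le> (\<Sum>l<n. a l x)"
            by (rule order_trans[OF sum_abs]) (auto simp: a_def intro!: sum_mono lip')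
          then show ?thesis using E_nonneg[of n x] by linarith
        qed
        finally have "\<bar>up \<sigma> x - lo \<sigma> x\<bar> powr r \<le> ((\<Sum>l<n. a l x) + E n x) powr r"
          using r by (intro powr_mono2) auto
        also have "\<dots> \<le> 2 powr r * ((\<Sum>l<n. a l x) powr r + E n x powr r)"
          using r a E_nonneg by (intro powr_add_le) (auto intro: sum_nonneg)
        also have "\<dots> \<le> 2 powr r * ((\<Sum>l<n. (a l x / w l) powr r) + E n x powr r)"
          using powr_sum_le_weighted[OF r, of "\<lambda>l. a l x" w n] a w by simp
        finally show ?thesis .
      qed
      have a_int: "(\<integral>\<^sup>+x. ennreal ((a l x / w l) powr r) \<partial>lborel) \<le> ennreal (w l * (\<epsilon> / 4) powr r)" if "l < n" for l
      proof -
        note [measurable] = meas[OF \<sigma> that]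
        define k where "k = L * (2 powr - \<alpha>) ^ l / w l"
        have k: "k > 0" using L w(1)[of l] by (simp add: k_def)
        have "(a l x / w l) powr r = k powr r * \<bar>stretch (R l) (snd (\<sigma> l)) x - stretch (R l) (fst (\<sigma> l)) x\<bar> powr r" for x
          using k by (simp add: a_def k_def powr_mult[symmetric])
        then have "(\<integral>\<^sup>+x. ennreal ((a l x / w l) powr r) \<partial>lborel)
            = ennreal (k powr r) * (\<integral>\<^sup>+x. ennreal (\<bar>stretch (R l) (snd (\<sigma> l)) x - stretch (R l) (fst (\<sigma> l)) x\<bar> powr r) \<partial>lborel)"
          by (simp add: ennreal_mult nn_integral_cmult)
        also have "\<dots> = ennreal (k powr r) * (ennreal (2 * R l) *
            (\<integral>\<^sup>+x. ennreal (\<bar>snd (\<sigma> l) x - fst (\<sigma> l) x\<bar> powr r) * indicator {0..<1} x \<partial>lborel))"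
          using R r by (subst nn_integral_stretch) auto
        also have "\<dots> \<le> ennreal (k powr r) * (ennreal (2 * R l) * ennreal (e l powr r))"
          by (intro mult_left_mono int[OF \<sigma> that]) auto
        also have "\<dots> = ennreal (k powr r * (2 * R l * e l powr r))"
          using R[of l] by (simp add: ennreal_mult)
        also have "\<dots> \<le> ennreal (w l * (\<epsilon> / 4) powr r)"
          unfolding k_def R_def by (intro ennreal_leI slice)
        finally show ?thesis .
      qed
      have am: "(\<lambda>x. ennreal ((a l x / w l) powr r)) \<in> borel_measurable lborel" if "l < n" for l
      proof -
        note [measurable] = meas[OF \<sigma> that]
        show ?thesis unfolding a_def by measurable
      qed
      have "(\<integral>\<^sup>+x. ennreal (\<bar>up \<sigma> x - lo \<sigma> x\<bar> powr r) \<partial>lborel)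
          \<le> (\<integral>\<^sup>+x. ennreal (2 powr r) * ((\<Sum>l<n. ennreal ((a l x / w l) powr r)) + ennreal (E n x powr r)) \<partial>lborel)"
        using pw by (intro nn_integral_mono)
          (auto simp: ennreal_plus[symmetric] ennreal_mult[symmetric] sum_nonneg simp del: ennreal_plus intro!: ennreal_leI)
      also have "\<dots> = ennreal (2 powr r) * ((\<Sum>l<n. \<integral>\<^sup>+x. ennreal ((a l x / w l) powr r) \<partial>lborel) + (\<integral>\<^sup>+x. ennreal (E n x powr r) \<partial>lborel))"
      proof -
        have m: "(\<lambda>x. \<Sum>l<n. ennreal ((a l x / w l) powr r)) \<in> borel_measurable lborel"
          by (intro borel_measurable_sum am) simp
        have mE: "(\<lambda>x. ennreal (E n x powr r)) \<in> borel_measurable lborel" by measurable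
        show ?thesis
          unfolding nn_integral_cmult[OF borel_measurable_add[OF m mE]] nn_integral_add[OF m mE]
          by (subst nn_integral_sum) (use am in \<open>simp_all del: sum_ennreal\<close>)
      qed
      also have "\<dots> \<le> ennreal (2 powr r) * ((\<Sum>l<n. ennreal (w l * (\<epsilon> / 4) powr r)) + ennreal ((\<epsilon> / 4) powr r))"
        using a_int n by (intro mult_left_mono add_mono sum_mono) auto
      also have "\<dots> = ennreal (2 powr r * (((\<Sum>l<n. w l) + 1) * (\<epsilon> / 4) powr r))"
        using w(1) by (simp add: sum_distrib_right[symmetric] ennreal_plus[symmetric] ennreal_mult[symmetric] sum_nonneg less_imp_le distrib_right del: ennreal_plus)
      also have "\<dots> \<le> ennreal (\<epsilon> powr r)"
      proof (rule ennreal_leI)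
        have "2 powr r * (((\<Sum>l<n. w l) + 1) * (\<epsilon> / 4) powr r) \<le> 2 powr r * (2 powr r * (\<epsilon> / 4) powr r)"
        proof (intro mult_left_mono mult_right_mono)
          have "(\<Sum>l<n. w l) + 1 \<le> 2 powr 1" using w(2)[of n] by simp
          also have "\<dots> \<le> 2 powr r" using r by (intro powr_mono) auto
          finally show "(\<Sum>l<n. w l) + 1 \<le> 2 powr r" .
        qed auto
        also have "\<dots> = (2 * (2 * (\<epsilon> / 4))) powr r" using \<epsilon> by (simp only: powr_mult)
        finally show "2 powr r * (((\<Sum>l<n. w l) + 1) * (\<epsilon> / 4) powr r) \<le> \<epsilon> powr r" by simp
      qed
      finally show ?thesis .
    qed
    define B where "B = (\<lambda>\<sigma>. (lo \<sigma>, up \<sigma>)) ` S"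
    have "real (card B) \<le> real (card S)" unfolding B_def using card_image_le[OF finS] by simp
    also have "\<dots> = (\<Prod>l<n. real (card (Bs l)))" by (simp add: S_def card_PiE)
    also have "\<dots> \<le> (\<Prod>l<n. exp (K * e l powr (- (1 / 2))))" by (intro prod_mono) (use Bs(1) in auto)
    also have "\<dots> = exp (\<Sum>l<n. K * e l powr (- (1 / 2)))" by (simp add: exp_sum)
    also have "\<dots> \<le> exp (K * c powr (- (1 / 2)) / (1 - b) * \<epsilon> powr (- (1 / 2)))" using e_sum by simp
    finally have card: "real (card B) \<le> exp (K * c powr (- (1 / 2)) / (1 - b) * \<epsilon> powr (- (1 / 2)))" .
    have "bracket_cover UNIV r (\<epsilon> powr r) H B"
      unfolding bracket_cover_def
    proof (intro conjI ballI)
      show "finite B" using finS by (simp add: B_def)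
      fix p assume "p \<in> B"
      then obtain \<sigma> where \<sigma>: "\<sigma> \<in> S" "p = (lo \<sigma>, up \<sigma>)" by (auto simp: B_def)
      have "lo \<sigma> \<in> borel_measurable borel" "up \<sigma> \<in> borel_measurable borel"
        unfolding lo_def[abs_def] up_def[abs_def] using meas[OF \<sigma>(1)]
        by (auto intro!: borel_measurable_sum borel_measurable_add measurable_compose[OF borel_measurable_stretch])
      then show "case p of (l, u) \<Rightarrow> l \<in> borel_measurable borel \<and> u \<in> borel_measurable borel \<and>
        (\<integral>\<^sup>+x. ennreal (\<bar>u x - l x\<bar> powr r) * indicator UNIV x \<partial>lborel) \<le> ennreal (\<epsilon> powr r)"
        using err[OF \<sigma>(1)] \<sigma>(2) by simp
    next
      fix P assume "P \<in> H"
      then obtain f where f: "\<And>l. f l \<in> trunc_concave" "\<And>l x. R l \<le> \<bar>x\<bar> \<Longrightarrow> f l x = 0"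
        "\<And>n x. (\<Sum>l<n. \<gamma> l (f l x)) \<le> P x" "\<And>n x. P x \<le> (\<Sum>l<n. \<gamma> l (f l x)) + E n x"
        using H[of P] unfolding R_def by blast
      have "(\<lambda>x. f l (- R l + 2 * R l * x)) \<in> pinned_trunc_concave" for l
        unfolding pinned_trunc_concave_def
        by (intro CollectI conjI trunc_concave_affine[OF f(1)]) (use f(2) R[of l] in simp_all)
      then have "\<forall>l. \<exists>p. p \<in> Bs l \<and> (\<forall>x \<in> {0..<1}. fst p x \<le> f l (- R l + 2 * R l * x) \<and> f l (- R l + 2 * R l * x) \<le> snd p x)"
        using Bs(2) unfolding bracket_cover_def by (fastforce simp: case_prod_beta)
      then obtain p where p: "\<And>l. p l \<in> Bs l"
        "\<And>l x. x \<in> {0..<1} \<Longrightarrow> fst (p l) x \<le> f l (- R l + 2 * R l * x) \<and> f l (- R l + 2 * R l * x) \<le> snd (p l) x"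
        by metis
      define \<sigma> where "\<sigma> = restrict p {..<n}"
      have \<sigma>: "\<sigma> \<in> S" using p by (auto simp: \<sigma>_def S_def)
      have st: "stretch (R l) (fst (p l)) x \<le> f l x \<and> f l x \<le> stretch (R l) (snd (p l)) x" for l x
        by (rule stretch_between[of "R l" "f l"]) (use R f(2) p(2) in auto)
      have "lo \<sigma> x \<le> P x \<and> P x \<le> up \<sigma> x" for x
      proof
        have "lo \<sigma> x \<le> (\<Sum>l<n. \<gamma> l (f l x))" unfolding lo_def
          using st by (intro sum_mono monoD[OF mono]) (auto simp: \<sigma>_def)
        then show "lo \<sigma> x \<le> P x" using f(3)[where n = n and x = x] by linarith
        have "(\<Sum>l<n. \<gamma> l (f l x)) + E n x \<le> up \<sigma> x" unfolding up_def
          using st by (intro add_mono sum_mono monoD[OF mono]) (auto simp: \<sigma>_def)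
        then show "P x \<le> up \<sigma> x" using f(4)[where n = n and x = x] by linarith
      qed
      then show "\<exists>(l, u) \<in> B. \<forall>x \<in> UNIV. l x \<le> P x \<and> P x \<le> u x" using \<sigma> by (auto simp: B_def)
    qed
    then show "\<exists>B. real (card B) \<le> exp (K * c powr (- (1 / 2)) / (1 - b) * \<epsilon> powr (- (1 / 2))) \<and>
      bracket_cover UNIV r (\<epsilon> powr r) H B" using card by blast
  qed
qed

section \<open>Concave-function transformations\<close>

lemma real_fun_sqrt_transformation: "real_fun (sqrt_transformation h) y = sqrt (real_fun h y)"
  by (simp add: real_fun_def sqrt_transformation_def ennreal_powr_def powr_half_sqrt)

lemma limit_points_sqrt_transformation:
  "lower_limit_point (sqrt_transformation h) = lower_limit_point h"
  "upper_limit_point (sqrt_transformation h) = upper_limit_point h"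
proof -
  have "sqrt_transformation h y > 0 \<longleftrightarrow> h y > 0" "sqrt_transformation h y < \<infinity> \<longleftrightarrow> h y < \<infinity>" for y
    by (cases "h y"; auto simp: sqrt_transformation_def ennreal_powr_def zero_less_iff_neq_zero)+
  then show "lower_limit_point (sqrt_transformation h) = lower_limit_point h"
    "upper_limit_point (sqrt_transformation h) = upper_limit_point h"
    by (auto simp: lower_limit_point_def upper_limit_point_def)
qed

lemma transformation_pos:
  assumes "concave_function_transformation h" "lower_limit_point h < y"
  shows "h y > 0"
proof -
  obtain z where "h z > 0" "z < y"
    using assms(2) by (auto simp: lower_limit_point_def Inf_less_iff)
  then show ?thesis using assms(1) unfolding concave_function_transformation_def
    by (meson less_imp_le monoD less_le_trans)
qed

lemma transformation_finite:
  assumes "concave_function_transformation h" "y < upper_limit_point h"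
  shows "h y < \<infinity>"
proof -
  obtain z where "h z < \<infinity>" "y < z"
    using assms(2) by (auto simp: upper_limit_point_def less_Sup_iff)
  then show ?thesis using assms(1) unfolding concave_function_transformation_def
    by (meson less_imp_le monoD le_less_trans)
qed

lemma transformation_zero:
  assumes "concave_function_transformation h" "y \<le> lower_limit_point h"
  shows "h y = 0"
  using assms unfolding concave_function_transformation_def
  by (metis le_zero_eq monoD)

text \<open>By continuity at the upper limit point, where \<open>h\<close> is infinite, the level m
  is passed strictly below that point, in the range where \<open>h\<close> is finite and
  differentiable.\<close>

lemma transformation_ge_level:
  assumes h: "concave_function_transformation h" and "m < \<infinity>"
  obtains B :: real where "lower_limit_point h < B" "B < upper_limit_point h" "m < h B"
proof -
  let ?u = "upper_limit_point h"
  have "open (h -` {m<..})" using h by (intro open_vimage) (auto simp: concave_function_transformation_def)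
  moreover have "?u \<in> h -` {m<..}" using h assms(2) by (simp add: concave_function_transformation_def)
  ultimately obtain b where b: "b < ?u" "{b<..?u} \<subseteq> h -` {m<..}"
    using h open_left[of "h -` {m<..}" ?u "lower_limit_point h"] by (auto simp: concave_function_transformation_def)
  have "max b (lower_limit_point h) < ?u" using b h by (simp add: concave_function_transformation_def)
  then obtain B where "max b (lower_limit_point h) < ereal B" "ereal B < ?u"
    using ereal_dense2 by blast
  moreover from this have "ereal B \<in> {b<..?u}" by simp
  then have "m < h B" using b(2) by blast
  ultimately show thesis using that[of B] by simp
qed

text \<open>Two levels are produced for the decay estimate: positivity of \<open>h\<close> at A'
  will bound the superlevel sets, and the gap A - A' becomes a slope.\<close>

lemma transformation_le_level:
  assumes h: "concave_function_transformation h" and "0 < m"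
  obtains A' A :: real where "lower_limit_point h < A'" "A' < A" "A < upper_limit_point h" "h A < m"
proof -
  let ?l = "lower_limit_point h"
  have "open (h -` {..<m})" using h by (intro open_vimage) (auto simp: concave_function_transformation_def)
  moreover have "?l \<in> h -` {..<m}" using h assms(2) by (simp add: concave_function_transformation_def)
  ultimately obtain b where b: "?l < b" "{?l..<b} \<subseteq> h -` {..<m}"
    using h open_right[of "h -` {..<m}" ?l "upper_limit_point h"] by (auto simp: concave_function_transformation_def)
  have "?l < min b (upper_limit_point h)" using b h by (simp add: concave_function_transformation_def)
  then obtain A where A: "?l < ereal A" "ereal A < min b (upper_limit_point h)"
    using ereal_dense2 by blast
  then obtain A' where "?l < ereal A'" "ereal A' < ereal A" using ereal_dense2 by blast
  moreover have "ereal A \<in> {?l..<b}" using A by simp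
  then have "h A < m" using b(2) by blast
  ultimately show thesis using A that[of A' A] by simp
qed

lemma real_fun_tendsto_0:
  assumes h: "concave_function_transformation h" and "e > 0"
  obtains Y where "\<And>y. y \<le> Y \<Longrightarrow> sqrt (real_fun h y) \<le> e"
proof -
  have "open (h -` {..<ennreal (e\<^sup>2)})" using h by (intro open_vimage) (auto simp: concave_function_transformation_def)
  moreover have "-\<infinity> \<in> h -` {..<ennreal (e\<^sup>2)}" using h assms(2) by (simp add: concave_function_transformation_def)
  ultimately obtain Y where Y: "{..<ereal Y} \<subseteq> h -` {..<ennreal (e\<^sup>2)}" using open_MInfty by blast
  show thesis
  proof (rule that)
    fix y assume "y \<le> Y - 1"
    then have "ereal y \<in> {..<ereal Y}" by simp
    then have "h (ereal y) < ennreal (e\<^sup>2)" using Y by blast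
    then have "enn2real (h (ereal y)) \<le> e\<^sup>2" by (simp add: enn2real_leI less_imp_le)
    then show "sqrt (real_fun h y) \<le> e" using assms(2) by (simp add: real_fun_def real_le_lsqrt)
  qed
qed

lemma real_fun_mono:
  assumes h: "concave_function_transformation h" and "y \<le> z" "ereal z < upper_limit_point h"
  shows "real_fun h y \<le> real_fun h z"
  using assms transformation_finite[OF h assms(3)] unfolding real_fun_def
  by (intro enn2real_mono) (auto simp: concave_function_transformation_def monoD)

lemma continuous_real_fun:
  assumes h: "concave_function_transformation h" and "ereal z < upper_limit_point h"
  shows "isCont (real_fun h) z"
proof -
  have fin: "h (ereal z) < \<infinity>" by (rule transformation_finite[OF h assms(2)])
  have "isCont h (ereal z)"
    using h by (simp add: concave_function_transformation_def continuous_on_eq_continuous_at)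
  moreover have "isCont ereal z" by (simp add: continuous_at_ereal)
  ultimately have "isCont (\<lambda>x. h (ereal x)) z" by (rule isCont_o2[rotated])
  then have "((\<lambda>x. h (ereal x)) \<longlongrightarrow> ennreal (enn2real (h (ereal z)))) (at z)"
    using fin by (simp add: isCont_def ennreal_enn2real)
  then show ?thesis unfolding isCont_def real_fun_def by (rule tendsto_enn2real) simp
qed

lemma real_fun_sqrt_deriv:
  assumes h: "concave_function_transformation h"
  obtains D where
    "\<And>y. lower_limit_point h < ereal y \<Longrightarrow> ereal y < upper_limit_point h \<Longrightarrow>
       ((\<lambda>y. sqrt (real_fun h y)) has_real_derivative D y) (at y)"
    "continuous_on {y. lower_limit_point h < ereal y \<and> ereal y < upper_limit_point h} D"
proof -
  let ?S = "{y. lower_limit_point h < ereal y \<and> ereal y < upper_limit_point h}"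
  obtain D where D: "\<And>y. y \<in> ?S \<Longrightarrow> (real_fun h has_vector_derivative D y) (at y)" "continuous_on ?S D"
    using h by (auto simp: concave_function_transformation_def C1_differentiable_on_def)
  have pos: "real_fun h y > 0" if "y \<in> ?S" for y
    using transformation_pos[OF h, of "ereal y"] transformation_finite[OF h, of "ereal y"] that
    by (simp add: real_fun_def enn2real_positive_iff)
  show thesis
  proof (rule that[of "\<lambda>y. D y * (inverse (sqrt (real_fun h y)) / 2)"])
    fix y assume "lower_limit_point h < ereal y" "ereal y < upper_limit_point h"
    then have y: "y \<in> ?S" by simp
    show "((\<lambda>y. sqrt (real_fun h y)) has_real_derivative D y * (inverse (sqrt (real_fun h y)) / 2)) (at y)"
      using DERIV_chain2[OF DERIV_real_sqrt[OF pos[OF y]] D(1)[OF y, folded has_real_derivative_iff_has_vector_derivative]]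
      by (simp add: mult.commute)
  next
    have "continuous_on ?S (real_fun h)"
      using continuous_real_fun[OF h] by (auto intro!: continuous_at_imp_continuous_on)
    then show "continuous_on ?S (\<lambda>y. D y * (inverse (sqrt (real_fun h y)) / 2))"
      using pos D(2) by (auto intro!: continuous_intros simp: less_imp_neq[symmetric])
  qed
qed

text \<open>(T.1) and (T.2) enter only through this bound: it says that \<open>g\<close> increases at most as fast
  as \<open>y \<mapsto> (B + 1 - y) powr - \<alpha>\<close> up to a constant.\<close>

lemma transformation_increment_bound:
  assumes h: "concave_function_transformation h" and g: "g = sqrt_transformation h"
    and T1: "deriv (real_fun g) \<in> o[at_bot](\<lambda>y. \<bar>y\<bar> powr (- (\<alpha> + 1)))" and "\<alpha> > 0"
    and T2: "cond_T2 g" and B: "lower_limit_point h < ereal B" "ereal B < upper_limit_point h"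
  obtains L where "L > 0"
    "\<And>y z. y \<le> z \<Longrightarrow> z \<le> B \<Longrightarrow> real_fun g z - real_fun g y \<le> L * (B + 1 - z) powr (- (\<alpha> + 1)) * (z - y)"
proof -
  let ?lo = "lower_limit_point h"
  have gs: "real_fun g y = sqrt (real_fun h y)" for y by (simp add: g real_fun_sqrt_transformation)
  obtain D where D: "\<And>y. ?lo < ereal y \<Longrightarrow> ereal y < upper_limit_point h \<Longrightarrow> (real_fun g has_real_derivative D y) (at y)"
    and contD: "continuous_on {y. ?lo < ereal y \<and> ereal y < upper_limit_point h} D"
    using real_fun_sqrt_deriv[OF h] unfolding gs[symmetric] by blast
  have lt_up: "ereal y < upper_limit_point h" if "y \<le> B" for y
    using B(2) that by (meson ereal_less_eq(3) le_less_trans)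
  have "\<exists>L>0. \<forall>y. ?lo < ereal y \<longrightarrow> y \<le> B \<longrightarrow> D y \<le> L * (B + 1 - y) powr (- (\<alpha> + 1))"
  proof (cases "?lo = -\<infinity>")
    case True
    have "eventually (\<lambda>y. norm (deriv (real_fun g) y) \<le> 1 * norm (\<bar>y\<bar> powr (- (\<alpha> + 1)))) at_bot"
      using landau_o.smallD[OF T1, of 1] by simp
    then obtain Y where Y: "\<And>y. y \<le> Y \<Longrightarrow> \<bar>deriv (real_fun g) y\<bar> \<le> \<bar>y\<bar> powr (- (\<alpha> + 1))"
      by (auto simp: eventually_at_bot_linorder)
    \<comment> \<open>Below Z one has |y| \<ge> |B| + 1, hence |y| \<ge> (B + 1 - y) / 2. This turns
      the bound in |y| into one in B + 1 - y at the price of \<open>2 powr (\<alpha> + 1)\<close>.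
      Between Z and B, continuity of the derivative on a compact interval suffices.\<close>
    define Z where "Z = min Y (- (\<bar>B\<bar> + 1))"
    have "compact {Z..B}" "continuous_on {Z..B} D"
      using True lt_up by (auto intro!: continuous_on_subset[OF contD])
    then have "bounded (D ` {Z..B})" by (intro compact_imp_bounded compact_continuous_image)
    then obtain C where C: "C > 0" "\<And>y. y \<in> {Z..B} \<Longrightarrow> \<bar>D y\<bar> \<le> C" unfolding bounded_pos by auto
    define L where "L = 2 powr (\<alpha> + 1) + C * (B + 1 - Z) powr (\<alpha> + 1)"
    have Z: "Z < B" by (auto simp: Z_def)
    have "D y \<le> L * (B + 1 - y) powr (- (\<alpha> + 1))" if "y \<le> B" for y
    proof (cases "y \<le> Z")
      case True
      have y: "y \<le> Y" "\<bar>B\<bar> + 1 \<le> - y" using True by (auto simp: Z_def)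
      have "D y = deriv (real_fun g) y" using DERIV_imp_deriv[OF D, of y] \<open>?lo = -\<infinity>\<close> lt_up[OF that] by simp
      also have "\<dots> \<le> \<bar>y\<bar> powr (- (\<alpha> + 1))" using Y[OF y(1)] by simp
      also have "\<dots> \<le> ((B + 1 - y) / 2) powr (- (\<alpha> + 1))"
        using y that \<open>\<alpha> > 0\<close> by (intro powr_mono2') (auto simp: abs_le_iff)
      also have "\<dots> = 2 powr (\<alpha> + 1) * (B + 1 - y) powr (- (\<alpha> + 1))"
        unfolding powr_divide powr_minus[of 2] by (simp add: divide_inverse del: minus_add_distrib)
      also have "\<dots> \<le> L * (B + 1 - y) powr (- (\<alpha> + 1))"
        using C by (intro mult_right_mono) (auto simp: L_def)
      finally show ?thesis .
    next
      case False
      have "D y \<le> C" using C(2)[of y] that False by auto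
      also have "C = C * (B + 1 - Z) powr (\<alpha> + 1) * (B + 1 - Z) powr (- (\<alpha> + 1))"
        using Z by (simp add: mult.assoc powr_add[symmetric])
      also have "\<dots> \<le> C * (B + 1 - Z) powr (\<alpha> + 1) * (B + 1 - y) powr (- (\<alpha> + 1))"
        using C that False \<open>\<alpha> > 0\<close> by (intro mult_left_mono powr_mono2') auto
      also have "\<dots> \<le> L * (B + 1 - y) powr (- (\<alpha> + 1))"
        by (intro mult_right_mono) (auto simp: L_def)
      finally show ?thesis .
    qed
    moreover have "L > 0" using C by (auto simp: L_def intro!: add_pos_nonneg)
    ultimately show ?thesis by blast
  next
    case False
    then obtain l where l: "?lo = ereal l" using B by (cases ?lo) auto
    obtain C where C: "C > 0" "\<And>y. ?lo < ereal y \<Longrightarrow> y \<le> B \<Longrightarrow> deriv (real_fun g) y \<le> C"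
      using T2 B l unfolding cond_T2_def g limit_points_sqrt_transformation by auto
    have lB: "l < B" using B l by simp
    have "D y \<le> C * (B + 1 - l) powr (\<alpha> + 1) * (B + 1 - y) powr (- (\<alpha> + 1))" if "?lo < ereal y" "y \<le> B" for y
    proof -
      have "D y \<le> C" using C(2)[OF that] DERIV_imp_deriv[OF D[OF that(1) lt_up[OF that(2)]]] by simp
      also have "C = C * (B + 1 - l) powr (\<alpha> + 1) * (B + 1 - l) powr (- (\<alpha> + 1))"
        using lB by (simp add: mult.assoc powr_add[symmetric])
      also have "\<dots> \<le> C * (B + 1 - l) powr (\<alpha> + 1) * (B + 1 - y) powr (- (\<alpha> + 1))"
        using C that l \<open>\<alpha> > 0\<close> by (intro mult_left_mono powr_mono2') auto
      finally show ?thesis .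
    qed
    moreover have "C * (B + 1 - l) powr (\<alpha> + 1) > 0" using C lB by simp
    ultimately show ?thesis by blast
  qed
  then obtain L where L: "L > 0" "\<And>y. ?lo < ereal y \<Longrightarrow> y \<le> B \<Longrightarrow> D y \<le> L * (B + 1 - y) powr (- (\<alpha> + 1))"
    by blast
  have mvt: "real_fun g z - real_fun g y \<le> L * (B + 1 - z) powr (- (\<alpha> + 1)) * (z - y)"
    if "y < z" "z \<le> B" "?lo \<le> ereal y" for y z
  proof -
    have lo: "?lo < ereal x" if "y < x" for x using that \<open>?lo \<le> ereal y\<close> by (simp add: le_less_trans)
    have "isCont (real_fun g) x" if "x \<le> B" for x
      unfolding gs[abs_def] by (intro continuous_intros continuous_real_fun[OF h lt_up[OF that]])
    then have "continuous_on {y..z} (real_fun g)"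
      using \<open>z \<le> B\<close> by (auto intro!: continuous_at_imp_continuous_on)
    moreover have "real_fun g differentiable (at x)" if "y < x" "x < z" for x
      using D[OF lo[OF that(1)] lt_up[of x]] that \<open>z \<le> B\<close> real_differentiable_def by fastforce
    ultimately obtain l x where x: "y < x" "x < z" "DERIV (real_fun g) x :> l" "real_fun g z - real_fun g y = (z - y) * l"
      using MVT[OF \<open>y < z\<close>, of "real_fun g"] by blast
    have "l = D x" using x D[OF lo[OF x(1)] lt_up[of x]] \<open>z \<le> B\<close> by (auto intro: DERIV_unique)
    also have "\<dots> \<le> L * (B + 1 - x) powr (- (\<alpha> + 1))" using L(2)[OF lo[OF x(1)]] x \<open>z \<le> B\<close> by auto
    also have "\<dots> \<le> L * (B + 1 - z) powr (- (\<alpha> + 1))"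
      using L x \<open>z \<le> B\<close> \<open>\<alpha> > 0\<close> by (intro mult_left_mono powr_mono2') auto
    finally show ?thesis unfolding x(4) using \<open>y < z\<close> by (simp add: mult.commute mult_left_mono)
  qed
  show thesis
  proof (rule that[OF L(1)])
    fix y z :: real assume yz: "y \<le> z" "z \<le> B"
    let ?b = "L * (B + 1 - z) powr (- (\<alpha> + 1))"
    have zero: "real_fun g x = 0" if "ereal x \<le> ?lo" for x
      using transformation_zero[OF h that] unfolding gs by (simp add: real_fun_def)
    have b: "?b \<ge> 0" using L by simp
    consider "y = z" | "ereal z \<le> ?lo" | "?lo \<le> ereal y" "y < z" | "ereal y < ?lo" "?lo < ereal z"
      using yz by fastforce
    then show "real_fun g z - real_fun g y \<le> ?b * (z - y)"
    proof cases
      case 2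
      moreover have "ereal y \<le> ?lo" using 2 yz by (meson ereal_less_eq(3) order_trans)
      ultimately show ?thesis using zero b yz by simp
    next
      case 3
      then show ?thesis using mvt yz by simp
    next
      \<comment> \<open>Below the lower limit point \<open>g\<close> vanishes, so the increment is
        the one starting at l. The estimate \<open>mvt\<close> includes l by continuity, although no
        derivative is given there.\<close>
      case 4
      then obtain l where l: "?lo = ereal l" by (cases ?lo) auto
      have "real_fun g z - real_fun g l \<le> ?b * (z - l)" using mvt[of l z] 4 l yz by simp
      also have "\<dots> \<le> ?b * (z - y)" using 4 l b by (intro mult_left_mono) auto
      finally show ?thesis using zero[of y] zero[of l] 4 l by simp
    qed simp
  qed
qed

section \<open>Slicing the range\<close>

text \<open>Descend from y by doubling the distance to B + 1. With s = B + 1 - y, step k changes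
  \<open>G\<close> by at most \<open>L * s powr - \<alpha> * q ^ k\<close>, a geometric series, and
  far enough down \<open>G\<close> is below any given e > 0.\<close>

lemma increment_bound_imp_decay:
  fixes G :: "real \<Rightarrow> real"
  assumes "\<alpha> > 0" "L > 0"
    and inc: "\<And>y z. y \<le> z \<Longrightarrow> z \<le> B \<Longrightarrow> G z - G y \<le> L * (B + 1 - z) powr (- (\<alpha> + 1)) * (z - y)"
    and lim: "\<And>e. e > 0 \<Longrightarrow> \<exists>Y. \<forall>y \<le> Y. G y \<le> e"
    and "y \<le> B"
  shows "G y \<le> L / (1 - 2 powr - \<alpha>) * (B + 1 - y) powr - \<alpha>"
proof -
  define q where "q = 2 powr - \<alpha>"
  have "2 powr - \<alpha> < 2 powr 0" using \<open>\<alpha> > 0\<close> by (intro powr_less_mono) auto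
  then have q: "0 < q" "q < 1" by (auto simp: q_def)
  define s where "s = B + 1 - y"
  have s: "s \<ge> 1" using \<open>y \<le> B\<close> by (simp add: s_def)
  define z where "z k = B + 1 - 2 ^ k * s" for k :: nat
  have step: "G (z k) - G (z (Suc k)) \<le> L * s powr - \<alpha> * q ^ k" for k
  proof -
    have pos: "2 ^ k * s \<ge> 1" using s mult_mono[of 1 "2 ^ k" 1 s] by simp
    then have "G (z k) - G (z (Suc k)) \<le> L * (B + 1 - z k) powr (- (\<alpha> + 1)) * (z k - z (Suc k))"
      using s by (intro inc) (auto simp: z_def)
    also have "\<dots> = L * ((2 ^ k * s) powr (- (\<alpha> + 1)) * (2 ^ k * s) powr 1)"
    proof -
      have "B + 1 - z k = 2 ^ k * s" "z k - z (Suc k) = 2 ^ k * s" by (auto simp: z_def)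
      moreover have "(2 ^ k * s) powr 1 = 2 ^ k * s" by (rule powr_one) (use pos in linarith)
      ultimately show ?thesis by (simp only: mult.assoc)
    qed
    also have "(2 ^ k * s) powr (- (\<alpha> + 1)) * (2 ^ k * s) powr 1 = (2 ^ k * s) powr - \<alpha>"
      by (subst powr_add[symmetric]) simp
    also have "\<dots> = s powr - \<alpha> * q ^ k"
      by (simp add: powr_mult q_def powr_realpow[symmetric] powr_powr mult.commute)
    finally show ?thesis by (simp add: mult.assoc)
  qed
  have sum: "G y - G (z n) \<le> L * s powr - \<alpha> * (\<Sum>k<n. q ^ k)" for n
  proof (induction n)
    case (Suc n)
    then show ?case using step[of n] by (simp add: algebra_simps)
  qed (simp add: z_def s_def)
  have "G y \<le> L * s powr - \<alpha> * (1 / (1 - q)) + e" if e: "e > 0" for e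
  proof -
    obtain Y where Y: "\<And>y. y \<le> Y \<Longrightarrow> G y \<le> e" using lim[OF e] by blast
    obtain n where n: "B + 1 - Y < 2 ^ n" using real_arch_pow[of 2 "B + 1 - Y"] by auto
    have "2 ^ n * 1 \<le> 2 ^ n * s" using s by (intro mult_left_mono) auto
    then have "z n \<le> Y" using n unfolding z_def by linarith
    then have "G (z n) \<le> e" by (rule Y)
    moreover have "L * s powr - \<alpha> * (\<Sum>k<n. q ^ k) \<le> L * s powr - \<alpha> * (1 / (1 - q))"
      using q \<open>L > 0\<close> by (intro mult_left_mono sum_geometric_le) auto
    ultimately show ?thesis using sum[of n] by linarith
  qed
  then have "G y \<le> L * s powr - \<alpha> * (1 / (1 - q))" by (rule field_le_epsilon)
  then show ?thesis by (simp add: q_def s_def)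
qed

text \<open>The clamp to [0, 1] makes the slice monotone and Lipschitz on the whole line, as needed
  for bracket functions whose values may leave [0, 1]. Distances are taken from B + 1, so that slice
  0 ends exactly at B.\<close>

definition slice :: "(real \<Rightarrow> real) \<Rightarrow> real \<Rightarrow> nat \<Rightarrow> real \<Rightarrow> real" where
  "slice G B l t = G (B + 1 - 2 ^ Suc l + 2 ^ l * max 0 (min 1 t)) - G (B + 1 - 2 ^ Suc l)"

text \<open>The slices telescope: slice l is the difference of \<open>G\<close> at y capped by B + 1
  - 2^l and at y capped by B + 1 - 2^(l+1).\<close>

lemma sum_slice:
  assumes "y \<le> B"
  shows "(\<Sum>l<n. slice G B l ((y - (B + 1 - 2 ^ Suc l)) / 2 ^ l)) + G (min y (B + 1 - 2 ^ n)) = G y"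
proof (induction n)
  case 0
  then show ?case using assms by simp
next
  case (Suc n)
  define p :: real where "p = 2 ^ n"
  have p: "p > 0" by (simp add: p_def)
  have "slice G B n ((y - (B + 1 - 2 ^ Suc n)) / 2 ^ n) + G (min y (B + 1 - 2 ^ Suc n)) = G (min y (B + 1 - 2 ^ n))"
  proof -
    consider "y \<le> B + 1 - 2 * p" | "B + 1 - 2 * p < y" "y \<le> B + 1 - p" | "B + 1 - p < y" by linarith
    then show ?thesis
    proof cases
      case 1
      then have "(y - (B + 1 - 2 * p)) / p \<le> 0" using p by (simp add: divide_le_0_iff)
      then show ?thesis using 1 p by (simp add: slice_def p_def[symmetric] min_def max_def)
    next
      case 2
      define q where "q = (y - (B + 1 - 2 * p)) / p"
      have "0 \<le> q" "q \<le> 1" using 2 p by (auto simp: q_def field_simps)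
      then have "max 0 (min 1 q) = q" by simp
      moreover have "B + 1 - 2 * p + p * q = y" using p by (simp add: q_def)
      moreover have "min y (B + 1 - p) = y" "min y (B + 1 - 2 * p) = B + 1 - 2 * p" using 2 by auto
      ultimately show ?thesis by (simp add: slice_def p_def[symmetric] q_def[symmetric])
    next
      case 3
      then have "1 \<le> (y - (B + 1 - 2 * p)) / p" using p by (simp add: field_simps)
      then show ?thesis using 3 p by (simp add: slice_def p_def[symmetric] min_def max_def)
    qed
  qed
  then show ?case using Suc by simp
qed

lemma slice_clamp: "slice G B l (max 0 (min 1 t)) = slice G B l t"
  by (simp add: slice_def)

lemma slice_0: "slice G B l 0 = 0"
  by (simp add: slice_def)

lemma mono_slice:
  assumes "\<And>y z. y \<le> z \<Longrightarrow> z \<le> B \<Longrightarrow> G y \<le> G z"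
  shows "mono (slice G B l)"
proof (rule monoI)
  fix s t :: real assume "s \<le> t"
  then have "max 0 (min 1 s) \<le> max 0 (min 1 t)" by auto
  then have "2 ^ l * max 0 (min 1 s) \<le> 2 ^ l * max 0 (min 1 t)" by (intro mult_left_mono) auto
  moreover have "2 ^ l * max 0 (min 1 t) \<le> 2 ^ l * 1" by (intro mult_left_mono) auto
  moreover have "1 \<le> (2::real) ^ l" by simp
  ultimately show "slice G B l s \<le> slice G B l t"
    unfolding slice_def power_Suc by (intro diff_right_mono assms) linarith+
qed

text \<open>Slice l stretches [0, 1] by 2^l and stays at distance at least 2^l from B + 1, where the
  increment rate is at most L 2^(-(\<alpha> + 1) l).\<close>

lemma slice_lipschitz:
  assumes "\<alpha> > 0" "L > 0"
    and inc: "\<And>y z. y \<le> z \<Longrightarrow> z \<le> B \<Longrightarrow> G z - G y \<le> L * (B + 1 - z) powr (- (\<alpha> + 1)) * (z - y)"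
    and "s \<le> t"
  shows "slice G B l t - slice G B l s \<le> L * (2 powr - \<alpha>) ^ l * (t - s)"
proof -
  define p :: real where "p = 2 ^ l"
  have p: "p \<ge> 1" by (simp add: p_def)
  define s' t' where "s' = max 0 (min 1 s)" and "t' = max 0 (min 1 t)"
  have st: "0 \<le> s'" "s' \<le> t'" "t' \<le> 1" "t' - s' \<le> t - s" using \<open>s \<le> t\<close> by (auto simp: s'_def t'_def)
  have pst: "p * s' \<le> p * t'" "p * t' \<le> p" using st p by (auto simp: mult_left_le)
  have "slice G B l t - slice G B l s = G (B + 1 - 2 * p + p * t') - G (B + 1 - 2 * p + p * s')"
    by (simp add: slice_def p_def s'_def t'_def)
  also have "\<dots> \<le> L * (2 * p - p * t') powr (- (\<alpha> + 1)) * (p * t' - p * s')"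
    using inc[of "B + 1 - 2 * p + p * s'" "B + 1 - 2 * p + p * t'"] pst p by (simp add: algebra_simps)
  also have "\<dots> \<le> L * p powr (- (\<alpha> + 1)) * (p * t' - p * s')"
    using assms(1,2) pst p by (intro mult_right_mono mult_left_mono powr_mono2') auto
  also have "\<dots> = L * (p powr (- (\<alpha> + 1)) * p powr 1) * (t' - s')"
  proof -
    have "p powr 1 = p" using p by simp
    then show ?thesis by (simp only: right_diff_distrib[symmetric] mult.assoc)
  qed
  also have "p powr (- (\<alpha> + 1)) * p powr 1 = p powr - \<alpha>" by (subst powr_add[symmetric]) simp
  also have "\<dots> = (2 powr - \<alpha>) ^ l" by (simp add: p_def powr_realpow[symmetric] powr_powr mult.commute)
  also have "L * (2 powr - \<alpha>) ^ l * (t' - s') \<le> L * (2 powr - \<alpha>) ^ l * (t - s)"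
    using st \<open>L > 0\<close> by (intro mult_left_mono) auto
  finally show ?thesis .
qed

section \<open>Integrals of the tails\<close>

lemma nn_integral_one_plus_abs_powr_finite:
  assumes "p > (1::real)"
  shows "(\<integral>\<^sup>+x. ennreal ((1 + \<bar>x\<bar>) powr - p) \<partial>lborel) < \<infinity>"
proof -
  let ?I = "\<integral>\<^sup>+x. ennreal ((1 + x) powr - p) * indicator {0..} x \<partial>lborel"
  have "?I = ennreal (0 - (- ((1 + 0) powr (1 - p) / (p - 1))))"
  proof (rule nn_integral_FTC_atLeast)
    show "((\<lambda>x. - ((1 + x) powr (1 - p) / (p - 1))) has_real_derivative (1 + x) powr - p) (at x)" if "0 \<le> x" for x
    proof -
      have "((\<lambda>x. - ((1 + x) powr (1 - p) / (p - 1))) has_real_derivative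
          - ((1 - p) * (1 + x) powr - p / (p - 1))) (at x)"
      proof -
        have "((\<lambda>x. (1 + x) powr (1 - p)) has_real_derivative (1 - p) * (1 + x) powr (1 - p - 1) * 1) (at x)"
          by (rule DERIV_chain2[OF has_real_derivative_powr]) (use that in \<open>auto intro!: derivative_eq_intros\<close>)
        from DERIV_minus[OF DERIV_cdivide[OF this, of "p - 1"]] show ?thesis by simp
      qed
      moreover have "- ((1 - p) * (1 + x) powr - p / (p - 1)) = (1 + x) powr - p"
        using assms by (simp add: minus_divide_left left_diff_distrib[symmetric] minus_mult_left)
      ultimately show ?thesis by simp
    qed
    have "((\<lambda>x. (1 + x) powr (1 - p)) \<longlongrightarrow> 0) at_top"
      by (intro tendsto_neg_powr filterlim_tendsto_add_at_top[OF tendsto_const] filterlim_ident) (use assms in auto)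
    then have "((\<lambda>x. - ((1 + x) powr (1 - p) / (p - 1))) \<longlongrightarrow> - (0 / (p - 1))) at_top"
      by (intro tendsto_intros) (use assms in auto)
    then show "((\<lambda>x. - ((1 + x) powr (1 - p) / (p - 1))) \<longlongrightarrow> 0) at_top" by simp
  qed auto
  then have fin: "?I < \<infinity>" by simp
  have "(\<integral>\<^sup>+x. ennreal ((1 + \<bar>x\<bar>) powr - p) * indicator {..0} x \<partial>lborel)
      = ennreal \<bar>- 1\<bar> * (\<integral>\<^sup>+x. ennreal ((1 + \<bar>0 + - 1 * x\<bar>) powr - p) * indicator {..0} (0 + - 1 * x) \<partial>lborel)"
    by (rule nn_integral_real_affine) auto
  also have "\<dots> = ?I" by (auto intro!: nn_integral_cong split: split_indicator)
  finally have neg: "(\<integral>\<^sup>+x. ennreal ((1 + \<bar>x\<bar>) powr - p) * indicator {..0} x \<partial>lborel) = ?I" .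
  have "(\<integral>\<^sup>+x. ennreal ((1 + \<bar>x\<bar>) powr - p) \<partial>lborel)
      \<le> (\<integral>\<^sup>+x. (ennreal ((1 + x) powr - p) * indicator {0..} x + ennreal ((1 + \<bar>x\<bar>) powr - p) * indicator {..0} x) \<partial>lborel)"
    by (intro nn_integral_mono) (auto split: split_indicator)
  also have "\<dots> = ?I + ?I" by (subst nn_integral_add) (auto simp: neg)
  finally show ?thesis using fin by (auto simp: less_top[symmetric] top_unique)
qed

text \<open>The exponent \<open>\<alpha> * r\<close> > 1 is written as (p - 1) + p with p > 1: the
  second part is integrable, the first yields the uniform factor \<open>b ^ n\<close>.\<close>

lemma tail_integral_small:
  assumes "r \<ge> 1" "\<alpha> > 1 / r" "C > 0" "\<eta> > 0"
  shows "\<exists>n. (\<integral>\<^sup>+x. ennreal ((C * (2 ^ n + \<bar>x\<bar>) powr - \<alpha>) powr r) \<partial>lborel) \<le> ennreal \<eta>"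
proof -
  define p where "p = (\<alpha> * r + 1) / 2"
  have ar: "\<alpha> * r > 1" using assms by (simp add: field_simps)
  then have p: "p > 1" "p \<le> \<alpha> * r" by (auto simp: p_def)
  let ?I = "\<integral>\<^sup>+x. ennreal ((1 + \<bar>x\<bar>) powr - p) \<partial>lborel"
  obtain I where I: "?I = ennreal I" "I \<ge> 0"
    using nn_integral_one_plus_abs_powr_finite[OF p(1)] by (cases ?I) auto
  define b where "b = 2 powr - (p - 1)"
  have "2 powr - (p - 1) < 2 powr 0" using p by (intro powr_less_mono) auto
  then have b: "0 < b" "b < 1" by (auto simp: b_def)
  have pw: "(C * (2 ^ n + \<bar>x\<bar>) powr - \<alpha>) powr r \<le> C powr r * b ^ n * (1 + \<bar>x\<bar>) powr - p" for n :: nat and x :: real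
  proof -
    have one: "(1::real) \<le> 2 ^ n" by simp
    have "(C * (2 ^ n + \<bar>x\<bar>) powr - \<alpha>) powr r = C powr r * (2 ^ n + \<bar>x\<bar>) powr (- (p - 1) + - p)"
    proof -
      have "- \<alpha> * r = - (p - 1) + - p" by (simp add: p_def field_simps)
      then show ?thesis by (simp only: powr_mult powr_powr)
    qed
    also have "\<dots> = C powr r * ((2 ^ n + \<bar>x\<bar>) powr - (p - 1) * (2 ^ n + \<bar>x\<bar>) powr - p)"
      by (simp only: powr_add)
    also have "\<dots> \<le> C powr r * ((2 ^ n) powr - (p - 1) * (1 + \<bar>x\<bar>) powr - p)"
      using p one by (intro mult_left_mono mult_mono powr_mono2') (auto intro: add_pos_nonneg)
    also have "(2 ^ n) powr - (p - 1) = b ^ n"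
      by (simp add: b_def powr_realpow[symmetric] powr_powr mult.commute)
    finally show ?thesis by (simp add: mult.assoc)
  qed
  obtain n where n: "b ^ n < \<eta> / (C powr r * (I + 1))"
    using real_arch_pow_inv[of "\<eta> / (C powr r * (I + 1))" b] b assms I by auto
  have "(\<integral>\<^sup>+x. ennreal ((C * (2 ^ n + \<bar>x\<bar>) powr - \<alpha>) powr r) \<partial>lborel)
      \<le> (\<integral>\<^sup>+x. ennreal (C powr r * b ^ n) * ennreal ((1 + \<bar>x\<bar>) powr - p) \<partial>lborel)"
    using pw b by (intro nn_integral_mono) (auto simp: ennreal_mult[symmetric] intro!: ennreal_leI)
  also have "\<dots> = ennreal (C powr r * b ^ n) * ?I" by (rule nn_integral_cmult) measurable
  also have "\<dots> = ennreal (C powr r * b ^ n * I)" using b I by (simp add: ennreal_mult)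
  also have "\<dots> \<le> ennreal \<eta>"
  proof (rule ennreal_leI)
    have "C powr r * b ^ n * I \<le> C powr r * b ^ n * (I + 1)" using b by (intro mult_left_mono) auto
    also have "\<dots> = b ^ n * (C powr r * (I + 1))" by (simp add: mult_ac)
    also have "\<dots> \<le> \<eta>"
    proof -
      have "0 < C powr r * (I + 1)" using I assms by (intro mult_pos_pos) auto
      then show ?thesis using n by (simp only: pos_less_divide_eq less_imp_le)
    qed
    finally show "C powr r * b ^ n * I \<le> \<eta>" .
  qed
  finally show ?thesis by blast
qed

section \<open>Decay of the densities\<close>

lemma closed_proper_concave_combine:
  assumes "\<phi> \<in> closed_proper_concave" "ereal s \<le> \<phi> x" "ereal t \<le> \<phi> y" "0 \<le> u" "u \<le> 1"
  shows "ereal ((1 - u) * s + u * t) \<le> \<phi> ((1 - u) * x + u * y)"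
proof -
  have "convex (hypograph \<phi>)" using assms(1) by (simp add: closed_proper_concave_def)
  moreover have "(x, s) \<in> hypograph \<phi>" "(y, t) \<in> hypograph \<phi>" using assms by (auto simp: hypograph_def)
  ultimately have "(1 - u) *\<^sub>R (x, s) + u *\<^sub>R (y, t) \<in> hypograph \<phi>"
    using assms(4,5) unfolding convex_alt by blast
  then show ?thesis by (simp add: hypograph_def)
qed

text \<open>The superlevel set at a is convex, so it contains everything between 0 and x; the
  density is at least c there while its integral is 1.\<close>

lemma dens_superlevel_bounded:
  assumes h: "mono h" and \<phi>: "\<phi> \<in> closed_proper_concave"
    and int: "(\<integral>\<^sup>+x. h (\<phi> x) \<partial>lborel) = 1" and c: "0 < c" "ennreal c \<le> h (ereal a)"
    and "ereal a \<le> \<phi> 0" "ereal a \<le> \<phi> x"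
  shows "\<bar>x\<bar> \<le> 1 / c"
proof -
  have "ereal a \<le> \<phi> z" if "z \<in> {min 0 x..max 0 x}" for z
  proof (cases "x = 0")
    case False
    define u where "u = z / x"
    have u: "0 \<le> u" "u \<le> 1" "z = (1 - u) * 0 + u * x"
      using that False by (auto simp: u_def min_def max_def divide_simps split: if_splits)
    show ?thesis using closed_proper_concave_combine[OF \<phi> assms(6,7) u(1,2)] u(3) by (simp add: algebra_simps)
  qed (use that assms in auto)
  then have "ennreal c * indicator {min 0 x..max 0 x} z \<le> h (\<phi> z)" for z
    using order_trans[OF c(2) monoD[OF h]] by (auto split: split_indicator)
  then have "(\<integral>\<^sup>+z. ennreal c * indicator {min 0 x..max 0 x} z \<partial>lborel) \<le> (\<integral>\<^sup>+x. h (\<phi> x) \<partial>lborel)"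
    by (intro nn_integral_mono)
  also have "(\<integral>\<^sup>+z. ennreal c * indicator {min 0 x..max 0 x} z \<partial>lborel) = ennreal (c * \<bar>x\<bar>)"
    using c by (simp add: nn_integral_cmult_indicator ennreal_mult[symmetric] min_def max_def)
  finally have "c * \<bar>x\<bar> \<le> 1" using int by simp
  then show ?thesis using c by (simp add: field_simps)
qed

text \<open>At distance R from 0 the function \<phi> is below A', while \<phi> 0 > A. By concavity
  this descent with slope (A - A') / R persists beyond R. Nearer to 0 the bound \<phi> < B is
  enough, because the summand 1 in B + 1 absorbs \<kappa> |x|.\<close>

lemma dens_class_bounded_decay:
  assumes h: "concave_function_transformation h" and "M > 0"
    and A: "lower_limit_point h < ereal A'" "A' < A" "ereal A < upper_limit_point h" "h (ereal A) < ennreal (1 / M)"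
    and B: "ennreal M < h (ereal B)"
  obtains \<kappa> where "\<kappa> > 0"
    "\<And>p. p \<in> dens_class_bounded M h \<Longrightarrow> \<exists>\<phi> \<in> closed_proper_concave. p = h \<circ> \<phi> \<and>
       (\<forall>x. \<phi> x < ereal B \<and> \<phi> x \<le> ereal (B + 1 - \<kappa> * \<bar>x\<bar>))"
proof -
  have mono: "mono h" using h by (simp add: concave_function_transformation_def)
  define c where "c = enn2real (h (ereal A'))"
  have "ereal A' < upper_limit_point h" using A(2,3) by (meson ereal_less(2) less_ereal.simps(1) less_trans)
  then have fin: "h (ereal A') < \<infinity>" by (rule transformation_finite[OF h])
  have c: "c > 0" "ennreal c \<le> h (ereal A')"
    using transformation_pos[OF h A(1)] fin by (auto simp: c_def enn2real_positive_iff ennreal_enn2real)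
  \<comment> \<open>The added 1 puts R strictly beyond the bound of
    \<open>dens_superlevel_bounded\<close>.\<close>
  define R where "R = 1 / c + 1"
  have R: "R > 1 / c" "R > 1" using c by (auto simp: R_def)
  define \<kappa> where "\<kappa> = min 1 (A - A') / R"
  have \<kappa>: "\<kappa> > 0" "\<kappa> \<le> 1 / R" "\<kappa> \<le> (A - A') / R" using R A(2) by (auto simp: \<kappa>_def intro: divide_right_mono)
  show thesis
  proof (rule that[OF \<kappa>(1)])
    fix p assume p: "p \<in> dens_class_bounded M h"
    then obtain \<phi> where \<phi>: "\<phi> \<in> closed_proper_concave" "p = h \<circ> \<phi>" and int: "(\<integral>\<^sup>+x. h (\<phi> x) \<partial>lborel) = 1"
      by (auto simp: dens_class_bounded_def dens_class_def comp_def)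
    have up: "\<phi> x < ereal B" for x
    proof (rule ccontr)
      assume "\<not> \<phi> x < ereal B"
      then have "h (ereal B) \<le> p x" using \<phi> monoD[OF mono] by (simp add: not_less)
      also have "\<dots> \<le> (SUP x. p x)" by (rule SUP_upper) simp
      also have "\<dots> \<le> ennreal M" using p by (simp add: dens_class_bounded_def)
      finally show False using B by simp
    qed
    have zero: "ereal A < \<phi> 0"
    proof (rule ccontr)
      assume "\<not> ereal A < \<phi> 0"
      then have "p 0 \<le> h (ereal A)" using \<phi> monoD[OF mono] by (simp add: not_less)
      moreover have "ennreal (1 / M) \<le> p 0" using p by (simp add: dens_class_bounded_def)
      ultimately show False using A(4) by simp
    qed
    have "ereal A < ereal B" using zero up[of 0] by (rule less_trans)
    then have AB: "A < B" by simp
    have A'0: "ereal A' \<le> \<phi> 0" using zero A(2) by (meson ereal_less_eq(3) less_imp_le order_trans)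
    have "\<phi> x \<le> ereal (B + 1 - \<kappa> * \<bar>x\<bar>)" for x
    proof (cases "\<bar>x\<bar> < R")
      case True
      have "\<kappa> * \<bar>x\<bar> \<le> 1 / R * \<bar>x\<bar>" using \<kappa> by (intro mult_right_mono) auto
      also have "\<dots> \<le> 1" using True R by simp
      finally have "ereal B \<le> ereal (B + 1 - \<kappa> * \<bar>x\<bar>)" by simp
      then show ?thesis using up[of x] by (meson less_imp_le order_trans)
    next
      case False
      show ?thesis
      proof (cases "\<phi> x")
        case (real t)
        define u where "u = R / \<bar>x\<bar>"
        have x: "\<bar>x\<bar> > 0" using False R by linarith
        have u: "0 < u" "u \<le> 1" using False R x by (auto simp: u_def)
        have "\<bar>u * x\<bar> = R" using x R by (simp add: u_def abs_mult)
        then have "\<not> ereal A' \<le> \<phi> (u * x)"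
          using dens_superlevel_bounded[OF mono \<phi>(1) int c A'0, of "u * x"] R by auto
        moreover have "ereal ((1 - u) * A + u * t) \<le> \<phi> ((1 - u) * 0 + u * x)"
          using u real zero by (intro closed_proper_concave_combine[OF \<phi>(1)]) (auto simp: less_imp_le)
        then have "ereal ((1 - u) * A + u * t) \<le> \<phi> (u * x)" by simp
        ultimately have "ereal ((1 - u) * A + u * t) < ereal A'" unfolding not_le by (rule le_less_trans[rotated])
        then have "u * (A - t) \<ge> A - A'" by (simp add: algebra_simps)
        then have "\<bar>x\<bar> / R * (A - A') \<le> \<bar>x\<bar> / R * (u * (A - t))" using R x by (intro mult_left_mono) auto
        also have "\<dots> = A - t" using R x by (simp add: u_def)
        finally have "(A - A') / R * \<bar>x\<bar> \<le> A - t" by (simp add: mult_ac)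
        moreover have "\<kappa> * \<bar>x\<bar> \<le> (A - A') / R * \<bar>x\<bar>" using \<kappa> by (intro mult_right_mono) auto
        ultimately show ?thesis using AB real by simp
      qed (use up[of x] in auto)
    qed
    then show "\<exists>\<phi> \<in> closed_proper_concave. p = h \<circ> \<phi> \<and>
       (\<forall>x. \<phi> x < ereal B \<and> \<phi> x \<le> ereal (B + 1 - \<kappa> * \<bar>x\<bar>))"
      using \<phi> up by blast
  qed
qed

text \<open>Affine rescaling and capping at 1 keep concavity. The value -\<infinity> is treated
  apart because \<open>real_of_ereal\<close> maps it to 0, which may lie above the level c.\<close>

lemma trunc_concave_slice:
  assumes \<phi>: "\<phi> \<in> closed_proper_concave" and "d > 0"
  shows "(\<lambda>x. if \<phi> x = -\<infinity> then 0 else max 0 (min 1 ((real_of_ereal (\<phi> x) - c) / d))) \<in> trunc_concave"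
    (is "?f \<in> _")
  unfolding trunc_concave_def
proof (intro CollectI conjI allI impI)
  fix x y s :: real assume *: "0 < ?f x" "0 < ?f y" "0 \<le> s" "s \<le> 1"
  let ?z = "(1 - s) * x + s * y"
  have fin: "\<phi> x < \<infinity>" for x using \<phi> by (simp add: closed_proper_concave_def)
  obtain X Y where XY: "\<phi> x = ereal X" "\<phi> y = ereal Y"
    using * fin[of x] fin[of y] by (cases "\<phi> x"; cases "\<phi> y") (auto split: if_splits)
  have "ereal ((1 - s) * X + s * Y) \<le> \<phi> ?z"
    using XY * by (intro closed_proper_concave_combine[OF \<phi>]) auto
  then obtain Z where Z: "\<phi> ?z = ereal Z" "(1 - s) * X + s * Y \<le> Z" using fin[of ?z] by (cases "\<phi> ?z") auto
  have f: "?f x \<le> 1" "?f x \<le> (X - c) / d" "?f y \<le> 1" "?f y \<le> (Y - c) / d"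
    using * XY by (auto simp: max_def split: if_splits)
  have "(1 - s) * ?f x + s * ?f y \<le> (1 - s) * 1 + s * 1"
    using f * by (intro add_mono mult_left_mono) auto
  moreover have "(1 - s) * ?f x + s * ?f y \<le> (1 - s) * ((X - c) / d) + s * ((Y - c) / d)"
    using f * by (intro add_mono mult_left_mono) auto
  moreover have "(1 - s) * ((X - c) / d) + s * ((Y - c) / d) = ((1 - s) * X + s * Y - c) / d"
    using \<open>d > 0\<close> by (simp add: field_simps)
  moreover have "((1 - s) * X + s * Y - c) / d \<le> (Z - c) / d"
    using Z \<open>d > 0\<close> by (intro divide_right_mono) auto
  ultimately have "(1 - s) * ?f x + s * ?f y \<le> min 1 ((Z - c) / d)" by (simp del: min_less_iff_conj)
  also have "\<dots> \<le> ?f ?z" using Z by simp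
  finally show "(1 - s) * ?f x + s * ?f y \<le> ?f ?z" .
qed auto

section \<open>From bracket covers to the bracketing number\<close>

lemma log_bracketing_number_le:
  assumes "bracket_cover UNIV r (\<epsilon> powr r) F B" "real (card B) \<le> exp x" "\<epsilon> > 0" "r \<ge> 1"
  shows "log_enat (bracketing_number \<epsilon> F r) \<le> ereal x"
proof -
  have dist: "Lr_dist r l u \<le> ennreal \<epsilon>" if "(l, u) \<in> B" for l u
  proof -
    let ?I = "\<integral>\<^sup>+x. ennreal (\<bar>l x - u x\<bar> powr r) \<partial>lborel"
    have I: "?I \<le> ennreal (\<epsilon> powr r)"
      using assms(1) that by (auto simp: bracket_cover_def abs_minus_commute)
    then have "enn2real ?I \<le> \<epsilon> powr r" by (rule enn2real_leI[rotated]) simp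
    then have "enn2real ?I powr (1 / r) \<le> (\<epsilon> powr r) powr (1 / r)" using assms by (intro powr_mono2) auto
    also have "\<dots> = \<epsilon>" using assms by (simp add: powr_powr)
    finally have "ennreal (enn2real ?I powr (1 / r)) \<le> ennreal \<epsilon>" by (rule ennreal_leI)
    moreover have "?I \<noteq> \<infinity>" using I by (auto simp: top_unique)
    ultimately show ?thesis by (simp add: Lr_dist_def ennreal_powr_def)
  qed
  have "bracketing_number \<epsilon> F r \<le> enat (card B)"
    unfolding bracketing_number_def
  proof (rule INF_lower, intro CollectI conjI)
    show "F \<subseteq> (\<Union>(l, u) \<in> B. {l..u})"
    proof
      fix f assume "f \<in> F"
      then obtain l u where "(l, u) \<in> B" "\<forall>x. l x \<le> f x \<and> f x \<le> u x"
        using assms(1) unfolding bracket_cover_def by blast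
      then show "f \<in> (\<Union>(l, u) \<in> B. {l..u})" by (auto simp: le_fun_def intro!: bexI[of _ "(l, u)"])
    qed
  qed (use assms(1) dist in \<open>auto simp: bracket_cover_def\<close>)
  then obtain k where k: "bracketing_number \<epsilon> F r = enat k" "k \<le> card B"
    by (cases "bracketing_number \<epsilon> F r") auto
  show ?thesis
  proof (cases "k = 0")
    case False
    have "real k \<le> exp x" using k(2) assms(2) by linarith
    then have "ln (real k) \<le> ln (exp x)" using False by (subst ln_le_cancel_iff) auto
    then have "ln (real k) \<le> x" by simp
    then show ?thesis using k False by (simp add: log_enat_def)
  qed (simp add: k log_enat_def)
qed

theorem theorem4p2:
  fixes h :: "ereal \<Rightarrow> ennreal" and g :: "ereal \<Rightarrow> ennreal" and r M :: real
  assumes "r \<ge> 1" and "M > 0"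
    and "concave_function_transformation h"
    and "g = sqrt_transformation h"
    and "cond_T1 g r" and "cond_T2 g" and "cond_T3 g" and "cond_T4 g"
  shows "\<exists>K::real. \<forall>\<epsilon>>0.
           log_enat (bracketing_number \<epsilon> (sqrt_dens_class M h) r) \<le> ereal (K * \<epsilon> powr (-(1/2)))"
proof -
  note h = assms(3)
  obtain \<alpha> where \<alpha>: "\<alpha> > 1 / r" and T1: "deriv (real_fun g) \<in> o[at_bot](\<lambda>y. \<bar>y\<bar> powr (- (\<alpha> + 1)))"
    using assms(5) unfolding cond_T1_def by auto
  have "0 < 1 / r" using \<open>r \<ge> 1\<close> by simp
  then have \<alpha>_pos: "\<alpha> > 0" using \<alpha> by linarith
  define G where "G = real_fun g"
  have G: "G y = sqrt (real_fun h y)" for y by (simp add: G_def assms(4) real_fun_sqrt_transformation)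
  \<comment> \<open>B lies above all values of \<phi> because h B > M; the level A chosen next lies
    below \<phi> 0 because h A < 1 / M.\<close>
  obtain B where B: "lower_limit_point h < ereal B" "ereal B < upper_limit_point h" "ennreal M < h (ereal B)"
    using transformation_ge_level[OF h, of "ennreal M"] by auto
  obtain A' A where A: "lower_limit_point h < ereal A'" "A' < A" "ereal A < upper_limit_point h" "h (ereal A) < ennreal (1 / M)"
    using transformation_le_level[OF h, of "ennreal (1 / M)"] \<open>M > 0\<close> by auto
  obtain \<kappa> where \<kappa>: "\<kappa> > 0" and decay: "\<And>p. p \<in> dens_class_bounded M h \<Longrightarrow> \<exists>\<phi> \<in> closed_proper_concave. p = h \<circ> \<phi> \<and>
       (\<forall>x. \<phi> x < ereal B \<and> \<phi> x \<le> ereal (B + 1 - \<kappa> * \<bar>x\<bar>))"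
    using dens_class_bounded_decay[OF h \<open>M > 0\<close> A B(3)] by metis
  obtain L where L: "L > 0"
    and inc: "\<And>y z. y \<le> z \<Longrightarrow> z \<le> B \<Longrightarrow> G z - G y \<le> L * (B + 1 - z) powr (- (\<alpha> + 1)) * (z - y)"
    using transformation_increment_bound[OF h assms(4) T1 \<alpha>_pos assms(6) B(1,2)] unfolding G_def by metis
  have G_mono: "G y \<le> G z" if "y \<le> z" "z \<le> B" for y z
  proof -
    have "ereal z < upper_limit_point h" using B(2) that(2) by (meson ereal_less_eq(3) le_less_trans)
    then show ?thesis unfolding G using real_fun_mono[OF h that(1)] by simp
  qed
  have G_nonneg: "G y \<ge> 0" for y by (simp add: G real_fun_def)
  define C1 where "C1 = L / (1 - 2 powr - \<alpha>)"
  have "2 powr - \<alpha> < 2 powr 0" using \<alpha>_pos by (intro powr_less_mono) auto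
  then have C1: "C1 > 0" using L by (simp add: C1_def)
  have "\<exists>Y. \<forall>y \<le> Y. G y \<le> e" if "e > 0" for e
    unfolding G using real_fun_tendsto_0[OF h that] by metis
  then have G_decay: "G y \<le> C1 * (B + 1 - y) powr - \<alpha>" if "y \<le> B" for y
    unfolding C1_def by (intro increment_bound_imp_decay[OF \<alpha>_pos L inc _ that])
  \<comment> \<open>Averaging the lower bounds \<kappa> |x| and 2^n for the distance from B + 1
    gives at least m (2^n + |x|).\<close>
  define m where "m = min 1 \<kappa> / 2"
  have m: "m > 0" "2 * m \<le> 1" "2 * m \<le> \<kappa>" using \<kappa> by (auto simp: m_def)
  define C2 where "C2 = C1 * m powr - \<alpha>"
  have C2: "C2 > 0" using C1 m by (simp add: C2_def)
  define E where "E n x = C2 * (2 ^ n + \<bar>x\<bar>) powr - \<alpha>" for n :: nat and x :: real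
  obtain K where K: "\<And>\<epsilon>. \<epsilon> > 0 \<Longrightarrow> \<exists>F. real (card F) \<le> exp (K * \<epsilon> powr (- (1 / 2))) \<and>
    bracket_cover UNIV r (\<epsilon> powr r) (sqrt_dens_class M h) F"
  \<comment> \<open>The radius 2 / \<kappa> arises because slice l is positive only where \<phi>
    exceeds B + 1 - 2^(l+1), and there \<kappa> |x| < 2^(l+1).\<close>
  proof (rule sliced_class_brackets[of r \<alpha> L "2 / \<kappa>" "slice G B" E "sqrt_dens_class M h"])
    show "mono (slice G B l)" for l by (rule mono_slice[OF G_mono])
    show "slice G B l t - slice G B l s \<le> L * (2 powr - \<alpha>) ^ l * (t - s)" if "s \<le> t" for l s t
      by (rule slice_lipschitz[OF \<alpha>_pos L inc that])
    show "\<exists>n. (\<integral>\<^sup>+x. ennreal (E n x powr r) \<partial>lborel) \<le> ennreal \<eta>" if "\<eta> > 0" for \<eta>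
      unfolding E_def by (rule tail_integral_small[OF \<open>r \<ge> 1\<close> \<alpha> C2 that])
    show "E n \<in> borel_measurable borel" for n unfolding E_def[abs_def] by measurable
    fix P assume "P \<in> sqrt_dens_class M h"
    then obtain p where p: "p \<in> dens_class_bounded M h" "P = (\<lambda>x. sqrt (enn2real (p x)))"
      by (auto simp: sqrt_dens_class_def)
    obtain \<phi> where \<phi>: "\<phi> \<in> closed_proper_concave" "p = h \<circ> \<phi>" "\<And>x. \<phi> x < ereal B"
      "\<And>x. \<phi> x \<le> ereal (B + 1 - \<kappa> * \<bar>x\<bar>)"
      using decay[OF p(1)] by metis
    define f where "f l x = (if \<phi> x = -\<infinity> then 0 else max 0 (min 1 ((real_of_ereal (\<phi> x) - (B + 1 - 2 ^ Suc l)) / 2 ^ l)))"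
      for l :: nat and x
    have P: "(\<Sum>l<n. slice G B l (f l x)) \<le> P x \<and> P x \<le> (\<Sum>l<n. slice G B l (f l x)) + E n x" for n x
    proof (cases "\<phi> x")
      case (real y)
      have y: "y \<le> B" "y \<le> B + 1 - \<kappa> * \<bar>x\<bar>" using \<phi>(3,4)[of x] real by auto
      have "P x = G y" using real by (simp add: p(2) \<phi>(2) G real_fun_def)
      moreover have "(\<Sum>l<n. slice G B l (f l x)) + G (min y (B + 1 - 2 ^ n)) = G y"
        using sum_slice[OF y(1), of G n] real by (simp add: f_def slice_clamp)
      moreover have "G (min y (B + 1 - 2 ^ n)) \<le> E n x"
      proof -
        let ?w = "B + 1 - min y (B + 1 - 2 ^ n)"
        have "2 * m * \<bar>x\<bar> \<le> \<kappa> * \<bar>x\<bar>" "2 * m * 2 ^ n \<le> 1 * 2 ^ n" using m by (auto intro: mult_right_mono)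
        moreover have "\<kappa> * \<bar>x\<bar> \<le> ?w" "2 ^ n \<le> ?w" using y by auto
        ultimately have w: "m * (2 ^ n + \<bar>x\<bar>) \<le> ?w" by (simp only: distrib_left)
        have "G (min y (B + 1 - 2 ^ n)) \<le> C1 * ?w powr - \<alpha>" using y by (intro G_decay) auto
        also have "\<dots> \<le> C1 * (m * (2 ^ n + \<bar>x\<bar>)) powr - \<alpha>"
          using C1 m w \<alpha>_pos by (intro mult_left_mono powr_mono2') (auto intro!: mult_pos_pos add_pos_nonneg)
        finally show ?thesis by (simp add: E_def C2_def powr_mult mult.assoc)
      qed
      ultimately show ?thesis using G_nonneg[of "min y (B + 1 - 2 ^ n)"] by linarith
    next
      case MInf
      have "P x = 0" using MInf h by (simp add: p(2) \<phi>(2) concave_function_transformation_def)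
      then show ?thesis using MInf C2 by (simp add: f_def slice_0 E_def)
    qed (use \<phi>(3)[of x] in simp)
    have "f l x = 0" if "2 / \<kappa> * 2 ^ l \<le> \<bar>x\<bar>" for l x
    proof (cases "\<phi> x")
      case (real y)
      have "2 * 2 ^ l \<le> \<kappa> * \<bar>x\<bar>" using that \<kappa> by (simp add: field_simps)
      then have "(y - (B + 1 - 2 ^ Suc l)) / 2 ^ l \<le> 0"
        using \<phi>(4)[of x] real by (intro divide_nonpos_pos) auto
      then show ?thesis using real by (simp add: f_def)
    qed (use \<phi>(3)[of x] in \<open>auto simp: f_def\<close>)
    moreover have "f l \<in> trunc_concave" for l
      unfolding f_def[abs_def] by (rule trunc_concave_slice[OF \<phi>(1)]) simp
    ultimately show "\<exists>f. (\<forall>l. f l \<in> trunc_concave \<and> (\<forall>x. 2 / \<kappa> * 2 ^ l \<le> \<bar>x\<bar> \<longrightarrow> f l x = 0)) \<and>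
       (\<forall>n x. (\<Sum>l<n. slice G B l (f l x)) \<le> P x \<and> P x \<le> (\<Sum>l<n. slice G B l (f l x)) + E n x)"
      using P by blast
  qed (use \<open>r \<ge> 1\<close> \<alpha> L \<kappa> C2 in \<open>auto simp: E_def\<close>)
  show ?thesis
  proof (intro exI[of _ K] allI impI)
    fix \<epsilon> :: real assume "\<epsilon> > 0"
    then obtain F where "real (card F) \<le> exp (K * \<epsilon> powr (- (1 / 2)))"
      "bracket_cover UNIV r (\<epsilon> powr r) (sqrt_dens_class M h) F" using K by blast
    then show "log_enat (bracketing_number \<epsilon> (sqrt_dens_class M h) r) \<le> ereal (K * \<epsilon> powr (-(1/2)))"
      using \<open>\<epsilon> > 0\<close> \<open>r \<ge> 1\<close> by (intro log_bracketing_number_le)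
  qed
qed

end
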